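(* The problem Edge Dominating Set($k$) admits a logspace kernelization that runs in time $O(|E|^4)$ and returns an equivalent instance with $O(k^3)$ edges.
   Context: Edge Dominating Set($k$): given a graph $G=(V,E)$ and $k \in \mathbb{N}$ (the parameter), decide whether there is a set $S \subseteq E$ of at most $k$ edges such that every edge in $E \setminus S$ shares an endpoint with some edge in $S$. A kernelization for a parameterized problem is an algorithm that, given an instance $(x,k)$, computes in time polynomial in $|x|+k$ an instance $(x',k')$ with $|x'|+k' \leq g(k)$ for some computable $g$ such that $(x,k)$ is a yes-instance iff $(x',k')$ is a yes-instance (an equivalent instance). A logspace kernelization is a kernelization that uses only logarithmic working space (read-only input, write-only output). *)

theory Defs
  imports Complex_Main "HOL-Library.Landau_Symbols" "HOL-Library.Log_Nat"
begin

section \<open>Random access machines with read-only input and write-only output\<close>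

text \<open>
  The input is an array of natural numbers that can only be read, the output a sequence of natural
  numbers that can only be appended to, and the working memory maps addresses to natural numbers.
  Every instruction costs one time step. There is no multiplication, so that polynomially
  many steps only produce numbers with polynomially many bits and polynomial time has its usual
  meaning.
\<close>

datatype instr =
    Const nat nat      \<comment> \<open>\<open>M[a] := c\<close>\<close>
  | Add nat nat nat    \<comment> \<open>\<open>M[a] := M[b] + M[c]\<close>\<close>
  | Sub nat nat nat    \<comment> \<open>\<open>M[a] := M[b] - M[c]\<close>, truncated at 0\<close>
  | Load nat nat       \<comment> \<open>\<open>M[a] := M[M[b]]\<close>\<close>
  | Store nat nat      \<comment> \<open>\<open>M[M[a]] := M[b]\<close>\<close>
  | Read nat nat       \<comment> \<open>\<open>M[a] :=\<close> input word number \<open>M[b]\<close>, or 0 beyond the end of the input\<close>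
  | Write nat          \<comment> \<open>append \<open>M[a]\<close> to the output\<close>
  | Jump nat           \<comment> \<open>continue at the given instruction\<close>
  | JumpZero nat nat   \<comment> \<open>continue at the given instruction if \<open>M[a] = 0\<close>\<close>

type_synonym ram = "instr list"

record config =
  pc :: nat
  mem :: "nat \<Rightarrow> nat"
  outp :: "nat list"

definition init_config :: config where
  "init_config = \<lparr>pc = 0, mem = (\<lambda>_. 0), outp = []\<rparr>"

fun exec :: "nat list \<Rightarrow> instr \<Rightarrow> config \<Rightarrow> config" where
  "exec w (Const a c) s = s\<lparr>pc := Suc (pc s), mem := (mem s)(a := c)\<rparr>"
| "exec w (Add a b c) s = s\<lparr>pc := Suc (pc s), mem := (mem s)(a := mem s b + mem s c)\<rparr>"
| "exec w (Sub a b c) s = s\<lparr>pc := Suc (pc s), mem := (mem s)(a := mem s b - mem s c)\<rparr>"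
| "exec w (Load a b) s = s\<lparr>pc := Suc (pc s), mem := (mem s)(a := mem s (mem s b))\<rparr>"
| "exec w (Store a b) s = s\<lparr>pc := Suc (pc s), mem := (mem s)(mem s a := mem s b)\<rparr>"
| "exec w (Read a b) s =
     s\<lparr>pc := Suc (pc s),
       mem := (mem s)(a := (if mem s b < length w then w ! mem s b else 0))\<rparr>"
| "exec w (Write a) s = s\<lparr>pc := Suc (pc s), outp := outp s @ [mem s a]\<rparr>"
| "exec w (Jump l) s = s\<lparr>pc := l\<rparr>"
| "exec w (JumpZero a l) s = s\<lparr>pc := (if mem s a = 0 then l else Suc (pc s))\<rparr>"

text \<open>The machine halts when the program counter leaves the program.\<close>

definition halted :: "ram \<Rightarrow> config \<Rightarrow> bool" where
  "halted P s \<longleftrightarrow> length P \<le> pc s"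

definition step :: "ram \<Rightarrow> nat list \<Rightarrow> config \<Rightarrow> config" where
  "step P w s = (if halted P s then s else exec w (P ! pc s) s)"

definition config_at :: "ram \<Rightarrow> nat list \<Rightarrow> nat \<Rightarrow> config" where
  "config_at P w t = (step P w ^^ t) init_config"

definition halts :: "ram \<Rightarrow> nat list \<Rightarrow> bool" where
  "halts P w \<longleftrightarrow> (\<exists>t. halted P (config_at P w t))"

definition run_time :: "ram \<Rightarrow> nat list \<Rightarrow> nat" where
  "run_time P w = (LEAST t. halted P (config_at P w t))"

definition ram_output :: "ram \<Rightarrow> nat list \<Rightarrow> nat list" where
  "ram_output P w = outp (config_at P w (run_time P w))"

definition bits :: "nat \<Rightarrow> nat" where
  "bits n = nat (bitlen (int n))"

text \<open>
  The working space of a configuration is the number of bits of the addresses and contents of all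
  nonzero memory cells; input and output are not counted.
\<close>

definition config_space :: "config \<Rightarrow> nat" where
  "config_space s = (\<Sum>a | mem s a \<noteq> 0. bits a + bits (mem s a))"

definition run_space :: "ram \<Rightarrow> nat list \<Rightarrow> nat" where
  "run_space P w = Max ((\<lambda>t. config_space (config_at P w t)) ` {..run_time P w})"

text \<open>The sum in \<open>config_space\<close> never degenerates: only finitely many cells are nonzero.\<close>

lemma finite_nonzero_upd:
  fixes m :: "nat \<Rightarrow> nat"
  assumes "finite {a. m a \<noteq> 0}"
  shows "finite {a. (m(b := v)) a \<noteq> 0}"
  by (rule finite_subset[of _ "insert b {a. m a \<noteq> 0}"]) (use assms in auto)

lemma finite_nonzero_cells: "finite {a. mem (config_at P w t) a \<noteq> 0}"
proof (induction t)
  case 0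
  show ?case by (simp add: config_at_def init_config_def)
next
  case (Suc t)
  let ?s = "config_at P w t"
  have "finite {a. mem (exec w i ?s) a \<noteq> 0}" for i
    by (cases i) (simp_all add: finite_nonzero_upd[OF Suc] Suc del: fun_upd_apply neq0_conv)
  moreover have "config_at P w (Suc t) = step P w ?s"
    by (simp add: config_at_def)
  ultimately show ?case
    using Suc by (simp add: step_def)
qed

definition computable :: "(nat \<Rightarrow> nat) \<Rightarrow> bool" where
  "computable g \<longleftrightarrow> (\<exists>P. \<forall>n. halts P [n] \<and> ram_output P [n] = [g n])"


section \<open>Kernelizations\<close>

text \<open>
  An instance \<open>(x, k)\<close> of a parameterized problem consists of a word sequence \<open>x\<close> and the
  parameter \<open>k\<close>; it is presented to a machine as the sequence \<open>k # x\<close>. The size of \<open>x\<close> is its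
  number of bits, with one additional bit per word as a separator.
\<close>

definition size_of :: "nat list \<Rightarrow> nat" where
  "size_of x = (\<Sum>w\<leftarrow>x. bits w + 1)"

text \<open>
  A problem is given by the set \<open>I\<close> of its well-formed instances and the set \<open>L\<close> of its
  yes-instances.
\<close>

definition kernelization ::
    "ram \<Rightarrow> (nat list \<times> nat) set \<Rightarrow> (nat list \<times> nat) set \<Rightarrow> bool" where
  "kernelization P I L \<longleftrightarrow>
     (\<forall>(x, k) \<in> I. halts P (k # x)) \<and>
     (\<exists>T d. (\<lambda>n. real (T n)) \<in> O(\<lambda>n. real n ^ d) \<and>
            (\<forall>(x, k) \<in> I. run_time P (k # x) \<le> T (size_of x + k))) \<and>
     (\<exists>g. computable g \<and>
          (\<forall>(x, k) \<in> I. \<exists>x' k'. ram_output P (k # x) = k' # x' \<and> (x', k') \<in> I \<and>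
             size_of x' + k' \<le> g k \<and> ((x, k) \<in> L \<longleftrightarrow> (x', k') \<in> L)))"

definition logspace_kernelization ::
    "ram \<Rightarrow> (nat list \<times> nat) set \<Rightarrow> (nat list \<times> nat) set \<Rightarrow> bool" where
  "logspace_kernelization P I L \<longleftrightarrow>
     kernelization P I L \<and>
     (\<exists>S. (\<lambda>n. real (S n)) \<in> O(\<lambda>n. ln (real n)) \<and>
          (\<forall>(x, k) \<in> I. run_space P (k # x) \<le> S (size_of x + k)))"


section \<open>Edge Dominating Set\<close>

definition simple_graph :: "'a set \<Rightarrow> 'a set set \<Rightarrow> bool" where
  "simple_graph V E \<longleftrightarrow> finite V \<and> E \<subseteq> {e. e \<subseteq> V \<and> card e = 2}"

definition edge_dominating_set :: "'a set set \<Rightarrow> 'a set set \<Rightarrow> bool" where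
  "edge_dominating_set E S \<longleftrightarrow> S \<subseteq> E \<and> (\<forall>e \<in> E - S. \<exists>f \<in> S. e \<inter> f \<noteq> {})"

text \<open>
  A graph on the vertices \<open>0, \<dots>, n - 1\<close> is encoded by \<open>n\<close>, the list of its vertices, the number
  of edges, and the endpoints of the edges; each edge occurs exactly once, but the edges may come
  in any order and with either orientation. Since the vertices are listed, the size of the
  encoding is at least the number of vertices, isolated vertices included.
\<close>

definition encodes :: "nat list \<Rightarrow> nat set \<Rightarrow> nat set set \<Rightarrow> bool" where
  "encodes x V E \<longleftrightarrow> simple_graph V E \<and>
     (\<exists>n es. V = {..<n} \<and> E = (\<lambda>(u, v). {u, v}) ` set es \<and> length es = card E \<and>
        x = n # [0..<n] @ length es # concat (map (\<lambda>(u, v). [u, v]) es))"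

definition EDS_instances :: "(nat list \<times> nat) set" where
  "EDS_instances = {(x, k). \<exists>V E. encodes x V E}"

definition EDS :: "(nat list \<times> nat) set" where
  "EDS = {(x, k). \<exists>V E. encodes x V E \<and> (\<exists>S. edge_dominating_set E S \<and> card S \<le> k)}"

end

theory Submission
  imports Defs
begin

text \<open>
  Call a vertex high if its degree exceeds \<open>2k\<close>, and an edge low if neither end is high. At most
  \<open>2k\<close> vertices are covered by a solution of size \<open>k\<close>, so a solution covers every high vertex. An edge
  \<open>{h, v}\<close> is therefore dropped if \<open>h\<close> is high, \<open>v\<close> is not high and has only high neighbours, and at
  least \<open>2k + 1\<close> earlier edges of the input list contain \<open>h\<close>. The high vertices remain high, hence
  covered, so solutions of the kernel are solutions of the graph; conversely a dropped edge of a solution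
  only matters for covering \<open>h\<close> and may be replaced by any remaining edge at \<open>h\<close>. If there is a solution,
  each of the at most \<open>2k\<close> covered vertices is in \<open>O(k\<^sup>2)\<close> remaining edges: its edges to high vertices,
  to the \<open>O(k\<^sup>2)\<close> ends of low edges, and its first \<open>2k + 1\<close> edges.

  On the machine, all loops run over the edges of the input and are nested at most four deep. Nothing but
  counters and flags is stored, so every value is polynomially bounded; in particular, the
  vertices of the kernel are renamed by recomputing the list of the ends of the remaining edges
  and taking the last position in it.
\<close>

section \<open>A structured language compiled to the machine\<close>

text \<open>In logarithmic space neither the kernel nor an intermediate graph can be stored, so
  edges cannot be deleted one after another: whether an edge is kept must depend only on the input
  graph and the order of its edge list, and be recomputed whenever it is asked for. This is why
  surplus edges at a high vertex \<open>h\<close> are cut by counting earlier edges. Keeping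
  \<open>{h, v}\<close> when \<open>v\<close> lies on a low edge is forced as well: a solution may
  use \<open>{h, v}\<close> to dominate an edge at \<open>v\<close> without high end, and then an
  arbitrary edge at \<open>h\<close> cannot stand in for it. The four nested loops are: edge to be
  output, scan of the kept edges for a label, keep test, degrees. None runs over vertices, since the
  time bound mentions only \<open>|E|\<close>. The size bound must hold for no-instances too, so the
  kept edges are counted before any is output. The intermediate language separates the claims:
  correctness is read off \<open>sem\<close>, time off \<open>cost\<close> and \<open>depth\<close>,
  space off the shape of the instructions emitted by \<open>compile\<close>.\<close>

abbreviation (input) "ONE \<equiv> 0 :: nat"
abbreviation (input) "PAR \<equiv> 1 :: nat"
abbreviation (input) "EDGES \<equiv> 2 :: nat"
abbreviation (input) "PAR2 \<equiv> 3 :: nat"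
abbreviation (input) "BASE \<equiv> 4 :: nat"
abbreviation (input) "END \<equiv> 5 :: nat"
abbreviation (input) "TMP \<equiv> 6 :: nat"
abbreviation (input) "ZERO \<equiv> 7 :: nat"

text \<open>\<open>For x c\<close> runs through the edges of the input graph; in the body, cell \<open>x\<close> is the input
  position just after the current edge, and cells \<open>x + 1\<close>, \<open>x + 2\<close> hold its endpoints.\<close>

datatype com =
    Skip
  | SetTo nat nat
  | Inc nat
  | Copy nat nat
  | AddTo nat nat
  | Put nat
  | Seq com com (infixr ";;" 60)
  | IfLe nat nat com com
  | For nat com

definition read_word :: "nat list \<Rightarrow> nat \<Rightarrow> nat" where
  "read_word w p = (if p < length w then w ! p else 0)"

text \<open>\<open>TMP\<close> receives what the loop test \<open>END - x\<close> leaves there.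
  Recording even such by-products makes \<open>sem\<close> describe the complete memory, so that
  correctness of compiled code is an equality of configurations.\<close>

definition enter :: "nat list \<Rightarrow> nat \<Rightarrow> nat \<Rightarrow> nat \<Rightarrow> nat \<Rightarrow> config \<Rightarrow> config" where
  "enter w b m x i s = s\<lparr>mem := (mem s)(TMP := 2 * (m - i), Suc x := read_word w (b + 2 * i),
     Suc (Suc x) := read_word w (b + 2 * i + 1), x := b + 2 * i + 2)\<rparr>"

primrec sem :: "nat list \<Rightarrow> nat \<Rightarrow> nat \<Rightarrow> com \<Rightarrow> config \<Rightarrow> config" where
  "sem w b m Skip s = s"
| "sem w b m (SetTo a c) s = s\<lparr>mem := (mem s)(a := c)\<rparr>"
| "sem w b m (Inc a) s = s\<lparr>mem := (mem s)(a := Suc (mem s a))\<rparr>"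
| "sem w b m (Copy a c) s = s\<lparr>mem := (mem s)(a := mem s c)\<rparr>"
| "sem w b m (AddTo a c) s = s\<lparr>mem := (mem s)(a := mem s a + mem s c)\<rparr>"
| "sem w b m (Put a) s = s\<lparr>outp := outp s @ [mem s a]\<rparr>"
| "sem w b m (Seq c d) s = sem w b m d (sem w b m c s)"
| "sem w b m (IfLe x y c d) s =
     (let s' = s\<lparr>mem := (mem s)(TMP := mem s x - mem s y)\<rparr>
      in if mem s x \<le> mem s y then sem w b m c s' else sem w b m d s')"
| "sem w b m (For x c) s =
     (let s' = fold (\<lambda>i. sem w b m c \<circ> enter w b m x i) [0..<m] (s\<lparr>mem := (mem s)(x := b)\<rparr>)
      in s'\<lparr>mem := (mem s')(TMP := 0)\<rparr>)"

primrec writes :: "com \<Rightarrow> nat set" where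
  "writes Skip = {}"
| "writes (SetTo a c) = {a}"
| "writes (Inc a) = {a}"
| "writes (Copy a c) = {a}"
| "writes (AddTo a c) = {a}"
| "writes (Put a) = {}"
| "writes (Seq c d) = writes c \<union> writes d"
| "writes (IfLe x y c d) = insert TMP (writes c \<union> writes d)"
| "writes (For x c) = insert TMP (insert x (insert (Suc x) (insert (Suc (Suc x)) (writes c))))"

primrec silent :: "com \<Rightarrow> bool" where
  "silent Skip = True"
| "silent (SetTo a c) = True"
| "silent (Inc a) = True"
| "silent (Copy a c) = True"
| "silent (AddTo a c) = True"
| "silent (Put a) = False"
| "silent (Seq c d) = (silent c \<and> silent d)"
| "silent (IfLe x y c d) = (silent c \<and> silent d)"
| "silent (For x c) = silent c"

text \<open>Cells below 8 are reserved, and only \<open>ONE\<close>, \<open>PAR\<close> and \<open>EDGES\<close> may be added to other cells,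
  so that memory contents grow at most linearly with time. The bounds 2 on constants and 40 on
  addresses merely fit the program below.\<close>

primrec wf_com :: "com \<Rightarrow> bool" where
  "wf_com Skip = True"
| "wf_com (SetTo a c) = (8 \<le> a \<and> a < 40 \<and> c \<le> 2)"
| "wf_com (Inc a) = (8 \<le> a \<and> a < 40)"
| "wf_com (Copy a c) = (8 \<le> a \<and> a < 40)"
| "wf_com (AddTo a c) = (8 \<le> a \<and> a < 40 \<and> c \<le> 2)"
| "wf_com (Put a) = True"
| "wf_com (Seq c d) = (wf_com c \<and> wf_com d)"
| "wf_com (IfLe x y c d) = (wf_com c \<and> wf_com d)"
| "wf_com (For x c) = (8 \<le> x \<and> x < 38 \<and> x \<notin> writes c \<and> wf_com c)"

primrec code_len :: "com \<Rightarrow> nat" where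
  "code_len Skip = 0"
| "code_len (SetTo a c) = 1"
| "code_len (Inc a) = 1"
| "code_len (Copy a c) = 1"
| "code_len (AddTo a c) = 1"
| "code_len (Put a) = 1"
| "code_len (Seq c d) = code_len c + code_len d"
| "code_len (IfLe x y c d) = 3 + code_len c + code_len d"
| "code_len (For x c) = 8 + code_len c"

text \<open>The machine has no move and no comparison: copying subtracts the zero cell, and the
  truncated difference is 0 exactly if \<open>x \<le> y\<close>. As \<open>JumpZero\<close> skips
  ahead in that case, the else branch is laid out first.\<close>

primrec compile :: "nat \<Rightarrow> com \<Rightarrow> ram" where
  "compile off Skip = []"
| "compile off (SetTo a c) = [Const a c]"
| "compile off (Inc a) = [Add a a ONE]"
| "compile off (Copy a c) = [Sub a c ZERO]"
| "compile off (AddTo a c) = [Add a a c]"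
| "compile off (Put a) = [Write a]"
| "compile off (Seq c d) = compile off c @ compile (off + code_len c) d"
| "compile off (IfLe x y c d) =
     [Sub TMP x y, JumpZero TMP (off + 3 + code_len d)] @ compile (off + 2) d @
     [Jump (off + 3 + code_len d + code_len c)] @ compile (off + 3 + code_len d) c"
| "compile off (For x c) =
     [Sub x BASE ZERO, Sub TMP END x, JumpZero TMP (off + 8 + code_len c),
      Read (Suc x) x, Add x x ONE, Read (Suc (Suc x)) x, Add x x ONE] @
     compile (off + 7) c @ [Jump (off + 1)]"

text \<open>An upper bound rather than the exact time: a conditional is charged for both branches.
  The \<open>3\<close> of a loop is its initialisation and the final test; the \<open>7\<close> is
  the test, two reads, two increments and the jump back.\<close>

primrec cost :: "nat \<Rightarrow> com \<Rightarrow> nat" where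
  "cost m Skip = 0"
| "cost m (SetTo a c) = 1"
| "cost m (Inc a) = 1"
| "cost m (Copy a c) = 1"
| "cost m (AddTo a c) = 1"
| "cost m (Put a) = 1"
| "cost m (Seq c d) = cost m c + cost m d"
| "cost m (IfLe x y c d) = 3 + cost m c + cost m d"
| "cost m (For x c) = 3 + m * (7 + cost m c)"

primrec depth :: "com \<Rightarrow> nat" where
  "depth Skip = 0"
| "depth (SetTo a c) = 0"
| "depth (Inc a) = 0"
| "depth (Copy a c) = 0"
| "depth (AddTo a c) = 0"
| "depth (Put a) = 0"
| "depth (Seq c d) = max (depth c) (depth d)"
| "depth (IfLe x y c d) = max (depth c) (depth d)"
| "depth (For x c) = Suc (depth c)"

lemma length_compile [simp]: "length (compile off c) = code_len c"
  by (induction c arbitrary: off) auto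

text \<open>Only loops multiply the cost, each by at most a constant times \<open>m + 1\<close>; the
  constant \<open>A\<close> depends on the program alone.\<close>

lemma cost_le_power_depth: "\<exists>A. \<forall>m. cost m c \<le> A * (m + 1) ^ depth c"
proof (induction c)
  case (Seq c d)
  then obtain A B where AB: "\<And>m. cost m c \<le> A * (m + 1) ^ depth c"
    "\<And>m. cost m d \<le> B * (m + 1) ^ depth d" by blast
  have "cost m (Seq c d) \<le> (A + B) * (m + 1) ^ depth (Seq c d)" for m
  proof -
    have le: "A * (m + 1) ^ depth c \<le> A * (m + 1) ^ depth (Seq c d)"
      "B * (m + 1) ^ depth d \<le> B * (m + 1) ^ depth (Seq c d)"
      by (auto intro!: mult_le_mono2 power_increasing)
    show ?thesis
      using le_trans[OF AB(1) le(1)] le_trans[OF AB(2) le(2)] by (simp add: add_mono add_mult_distrib)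
  qed
  then show ?case by blast
next
  case (IfLe x y c d)
  then obtain A B where AB: "\<And>m. cost m c \<le> A * (m + 1) ^ depth c"
    "\<And>m. cost m d \<le> B * (m + 1) ^ depth d" by blast
  have "cost m (IfLe x y c d) \<le> (3 + A + B) * (m + 1) ^ depth (IfLe x y c d)" for m
  proof -
    have le: "A * (m + 1) ^ depth c \<le> A * (m + 1) ^ depth (IfLe x y c d)"
      "B * (m + 1) ^ depth d \<le> B * (m + 1) ^ depth (IfLe x y c d)"
      by (auto intro!: mult_le_mono2 power_increasing)
    have "3 \<le> 3 * (m + 1) ^ depth (IfLe x y c d)" by simp
    then show ?thesis using le_trans[OF AB(1) le(1)] le_trans[OF AB(2) le(2)]
      unfolding cost.simps add_mult_distrib by linarith
  qed
  then show ?case by blast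
next
  case (For x c)
  then obtain A where A: "\<And>m. cost m c \<le> A * (m + 1) ^ depth c" by blast
  have "cost m (For x c) \<le> (10 + A) * (m + 1) ^ depth (For x c)" for m
  proof -
    have "cost m (For x c) \<le> 3 * (m + 1) ^ depth (For x c) + m * (7 * (m + 1) ^ depth c + A * (m + 1) ^ depth c)"
      using A[of m] by (auto intro!: add_mono mult_le_mono2 simp del: power_Suc)
    also have "m * (7 * (m + 1) ^ depth c + A * (m + 1) ^ depth c) \<le> (7 + A) * (m + 1) ^ depth (For x c)"
      by (simp add: algebra_simps)
    finally show ?thesis by (simp add: algebra_simps)
  qed
  then show ?case by blast
qed (auto intro: exI[of _ 1])

section \<open>Frame properties and an invariant rule for loops\<close>

lemma enter_simps [simp]:
  "outp (enter w b m x i s) = outp s"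
  "y \<noteq> TMP \<Longrightarrow> y \<noteq> x \<Longrightarrow> y \<noteq> Suc x \<Longrightarrow> y \<noteq> Suc (Suc x) \<Longrightarrow> mem (enter w b m x i s) y = mem s y"
  "mem (enter w b m x i s) x = b + 2 * i + 2"
  "mem (enter w b m x i s) (Suc x) = read_word w (b + 2 * i)"
  "mem (enter w b m x i s) (Suc (Suc x)) = read_word w (b + 2 * i + 1)"
  by (auto simp: enter_def)

lemma sem_frame: "y \<notin> writes c \<Longrightarrow> mem (sem w b m c s) y = mem s y"
proof (induction c arbitrary: s)
  case (For x c)
  have "mem (fold (\<lambda>i. sem w b m c \<circ> enter w b m x i) is s') y = mem s' y" for "is" s'
    using For by (induction "is" arbitrary: s') auto
  with For.prems show ?case by (simp add: Let_def)
qed (auto simp: Let_def)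

lemma sem_silent: "silent c \<Longrightarrow> outp (sem w b m c s) = outp s"
proof (induction c arbitrary: s)
  case (For x c)
  have "outp (fold (\<lambda>i. sem w b m c \<circ> enter w b m x i) is s') = outp s'" for "is" s'
    using For by (induction "is" arbitrary: s') auto
  then show ?case by (simp add: Let_def)
qed (auto simp: Let_def)

text \<open>The invariant only has to speak of cells that the loop changes: the body may assume that
  all others still have their values from \<open>s\<close>. The arbitrary \<open>s'\<close> in
  \<open>init\<close> and the update of \<open>TMP\<close> in \<open>final\<close> absorb the
  initialisation and exit test of the loop itself.\<close>

lemma For_rule:
  assumes init: "\<And>s'. outp s' = outp s \<Longrightarrow> \<forall>y. y \<noteq> x \<longrightarrow> mem s' y = mem s y \<Longrightarrow> I 0 s'"
    and body: "\<And>i s'. i < m \<Longrightarrow> \<forall>y. y \<notin> writes (For x c) \<longrightarrow> mem s' y = mem s y \<Longrightarrow> I i s' \<Longrightarrow>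
      I (Suc i) (sem w b m c (enter w b m x i s'))"
    and final: "\<And>s' t. I m s' \<Longrightarrow> Q (s'\<lparr>mem := (mem s')(TMP := 0)\<rparr>)"
  shows "Q (sem w b m (For x c) s)"
proof -
  define st where
    "st n = fold (\<lambda>i. sem w b m c \<circ> enter w b m x i) [0..<n] (s\<lparr>mem := (mem s)(x := b)\<rparr>)" for n
  have st_Suc: "st (Suc n) = sem w b m c (enter w b m x n (st n))" for n
    by (simp add: st_def)
  have "I n (st n) \<and> (\<forall>y. y \<notin> writes (For x c) \<longrightarrow> mem (st n) y = mem s y)" if "n \<le> m" for n
    using that
  proof (induction n)
    case 0
    show ?case using init[of "st 0"] by (simp add: st_def)
  next
    case (Suc n)
    then show ?case using body[of n "st n"] by (simp add: st_Suc sem_frame)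
  qed
  from this[of m] final[of "st m"] show ?thesis by (simp add: Let_def st_def)
qed

subsection \<open>Correctness of the compiler\<close>

definition code_at :: "ram \<Rightarrow> nat \<Rightarrow> ram \<Rightarrow> bool" where
  "code_at P off c \<longleftrightarrow> (\<exists>p q. P = p @ c @ q \<and> length p = off)"

lemma code_at_append:
  assumes "code_at P off (c @ d)"
  shows "code_at P off c \<and> code_at P (off + length c) d"
proof -
  from assms obtain p q where pq: "P = p @ (c @ d) @ q" "length p = off"
    unfolding code_at_def by blast
  have "code_at P off c"
    unfolding code_at_def using pq by (intro exI[of _ p] exI[of _ "d @ q"]) simp
  moreover have "code_at P (off + length c) d"
    unfolding code_at_def using pq by (intro exI[of _ "p @ c"] exI[of _ q]) simp
  ultimately show ?thesis by blast
qed

lemma code_at_Cons: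
  assumes "code_at P off (i # d)"
  shows "off < length P \<and> P ! off = i \<and> code_at P (Suc off) d"
proof -
  from assms obtain p q where "P = p @ (i # d) @ q" "length p = off"
    unfolding code_at_def by blast
  moreover have "code_at P (off + length [i]) d"
    using code_at_append[of P off "[i]" d] assms by simp
  ultimately show ?thesis by (auto simp: nth_append)
qed

lemma step_at: "off < length P \<Longrightarrow> P ! off = i \<Longrightarrow> pc s = off \<Longrightarrow> step P w s = exec w i s"
  by (simp add: step_def halted_def)

definition reaches :: "ram \<Rightarrow> nat list \<Rightarrow> config \<Rightarrow> nat \<Rightarrow> config \<Rightarrow> bool" where
  "reaches P w s n s' \<longleftrightarrow> (\<exists>t\<le>n. (step P w ^^ t) s = s')"

lemma reaches_refl: "reaches P w s 0 s"
  by (auto simp: reaches_def)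

lemma reaches_trans:
  "reaches P w s n s' \<Longrightarrow> reaches P w s' n' s'' \<Longrightarrow> reaches P w s (n + n') s''"
proof -
  assume "reaches P w s n s'" "reaches P w s' n' s''"
  then obtain t t' where "t \<le> n" "(step P w ^^ t) s = s'" "t' \<le> n'" "(step P w ^^ t') s' = s''"
    by (auto simp: reaches_def)
  then have "(step P w ^^ (t' + t)) s = s''" "t' + t \<le> n + n'" by (auto simp: funpow_add)
  then show ?thesis unfolding reaches_def by blast
qed

lemma reaches_exec:
  "code_at P (pc s) (i # c) \<Longrightarrow> exec w i s = s' \<Longrightarrow> reaches P w s (Suc 0) s'"
  unfolding reaches_def by (rule exI[of _ "Suc 0"]) (auto dest!: code_at_Cons simp: step_at)

lemma reaches_mono: "reaches P w s n s' \<Longrightarrow> n \<le> n' \<Longrightarrow> reaches P w s n' s'"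
  unfolding reaches_def using le_trans by metis

text \<open>The cells that compiled code relies on; well-formed commands never write them.\<close>

definition ready :: "nat \<Rightarrow> nat \<Rightarrow> config \<Rightarrow> bool" where
  "ready b m s \<longleftrightarrow> mem s ONE = 1 \<and> mem s BASE = b \<and> mem s END = b + 2 * m \<and> mem s ZERO = 0"

lemma wf_writes: "wf_com c \<Longrightarrow> y \<in> writes c \<Longrightarrow> y = TMP \<or> 8 \<le> y"
  by (induction c) auto

lemma ready_sem: "wf_com c \<Longrightarrow> ready b m (sem w b m c s) = ready b m s"
proof -
  assume "wf_com c"
  then have "0 \<notin> writes c" "4 \<notin> writes c" "5 \<notin> writes c" "7 \<notin> writes c"
    using wf_writes[of c] by force+
  then show ?thesis by (simp add: ready_def sem_frame)
qed

lemma ready_upd: "ready b m (s\<lparr>mem := (mem s)(a := v)\<rparr>) = ready b m s" if "a = TMP \<or> 8 \<le> a"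
  using that by (auto simp: ready_def)

lemma ready_enter: "8 \<le> x \<Longrightarrow> ready b m (enter w b m x i s) = ready b m s"
  by (auto simp: ready_def)

lemma enter_pc: "enter w b m x i (s\<lparr>pc := p\<rparr>) = (enter w b m x i s)\<lparr>pc := p\<rparr>"
  by (simp add: enter_def)

lemma sem_pc: "sem w b m c (s\<lparr>pc := p\<rparr>) = (sem w b m c s)\<lparr>pc := p\<rparr>"
proof (induction c arbitrary: s)
  case (IfLe x y c d)
  have swap: "s\<lparr>pc := p, mem := f\<rparr> = s\<lparr>mem := f, pc := p\<rparr>" for f by simp
  show ?case by (simp add: Let_def IfLe swap del: fun_upd_apply)
next
  case (For x c)
  have fold_pc: "fold (\<lambda>i. sem w b m c \<circ> enter w b m x i) is (s\<lparr>pc := p\<rparr>) =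
      (fold (\<lambda>i. sem w b m c \<circ> enter w b m x i) is s)\<lparr>pc := p\<rparr>" for "is" s
    using For by (induction "is" arbitrary: s) (auto simp: enter_pc)
  have swap: "s\<lparr>pc := p, mem := f\<rparr> = s\<lparr>mem := f, pc := p\<rparr>" for f and s :: config by simp
  show ?case by (simp add: Let_def swap fold_pc del: fun_upd_apply)
qed simp_all

text \<open>Induction over the command: \<open>sem_pc\<close> lets each piece start at its own
  address, and \<open>ready\<close> survives because well-formed commands write no reserved cell but
  \<open>TMP\<close>.\<close>

lemma compile_correct:
  assumes "wf_com c" "ready b m s" "code_at P off (compile off c)" "pc s = off"
  shows "reaches P w s (cost m c) ((sem w b m c s)\<lparr>pc := off + code_len c\<rparr>)"
  using assms
proof (induction c arbitrary: s off)
  case Skip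
  then have "s\<lparr>pc := off\<rparr> = s" by simp
  then show ?case by (simp add: reaches_refl)
next
  case (SetTo a c)
  then show ?case by (auto intro!: reaches_exec)
next
  case (Inc a)
  then show ?case by (auto simp: ready_def intro!: reaches_exec)
next
  case (Copy a c)
  then show ?case by (auto simp: ready_def intro!: reaches_exec)
next
  case (AddTo a c)
  then show ?case by (auto intro!: reaches_exec)
next
  case (Put a)
  then show ?case by (auto intro!: reaches_exec)
next
  case (Seq c d)
  let ?s = "(sem w b m c s)\<lparr>pc := off + code_len c\<rparr>"
  have "reaches P w s (cost m c) ?s"
    using Seq.prems by (intro Seq.IH(1)) (auto dest: code_at_append)
  moreover have "reaches P w ?s (cost m d) ((sem w b m d ?s)\<lparr>pc := off + code_len c + code_len d\<rparr>)"
    using Seq.prems ready_sem[of c b m w s]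
    by (intro Seq.IH(2)) (auto dest: code_at_append simp: ready_def)
  ultimately show ?case by (auto dest: reaches_trans simp: sem_pc add.assoc)
next
  case (IfLe x y c d)
  let ?s = "s\<lparr>mem := (mem s)(TMP := mem s x - mem s y)\<rparr>"
  let ?e = "off + 3 + code_len d + code_len c"
  from IfLe.prems have at: "code_at P off (Sub TMP x y # JumpZero TMP (off + 3 + code_len d) #
      compile (off + 2) d @ Jump ?e # compile (off + 3 + code_len d) c)" by simp
  have d: "code_at P (off + 2) (compile (off + 2) d @ Jump ?e # compile (off + 3 + code_len d) c)"
    using at[THEN code_at_Cons] by (auto dest!: code_at_Cons)
  note d1 = d[THEN code_at_append, THEN conjunct1] and
    d2 = d[THEN code_at_append, THEN conjunct2, simplified]
  have c: "code_at P (off + 3 + code_len d) (compile (off + 3 + code_len d) c)"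
    using d2[THEN code_at_Cons] by (simp add: eval_nat_numeral)
  have rdy: "ready b m (?s\<lparr>pc := p\<rparr>)" for p using IfLe.prems by (simp add: ready_def)
  have 1: "reaches P w s (Suc 0) (?s\<lparr>pc := Suc off\<rparr>)"
    using at IfLe.prems by (auto intro!: reaches_exec)
  have at1: "code_at P (Suc off) (JumpZero TMP (off + 3 + code_len d) #
      compile (off + 2) d @ Jump ?e # compile (off + 3 + code_len d) c)"
    using at[THEN code_at_Cons] by simp
  show ?case
  proof (cases "mem s x \<le> mem s y")
    case True
    have 2: "reaches P w (?s\<lparr>pc := Suc off\<rparr>) (Suc 0) (?s\<lparr>pc := off + 3 + code_len d\<rparr>)"
      using at1 True by (intro reaches_exec[where i = "JumpZero TMP (off + 3 + code_len d)"]) auto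
    have 3: "reaches P w (?s\<lparr>pc := off + 3 + code_len d\<rparr>) (cost m c)
        ((sem w b m c (?s\<lparr>pc := off + 3 + code_len d\<rparr>))\<lparr>pc := ?e\<rparr>)"
      using IfLe.IH(1)[OF _ rdy c] IfLe.prems by simp
    have "reaches P w s (cost m (IfLe x y c d))
        ((sem w b m c (?s\<lparr>pc := off + 3 + code_len d\<rparr>))\<lparr>pc := ?e\<rparr>)"
      by (rule reaches_mono[OF reaches_trans[OF 1 reaches_trans[OF 2 3]]]) simp
    then show ?thesis using True by (simp add: Let_def ac_simps sem_pc del: fun_upd_apply)
  next
    case False
    have 2: "reaches P w (?s\<lparr>pc := Suc off\<rparr>) (Suc 0) (?s\<lparr>pc := off + 2\<rparr>)"
      using at1 False by (intro reaches_exec[where i = "JumpZero TMP (off + 3 + code_len d)"]) auto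
    have 3: "reaches P w (?s\<lparr>pc := off + 2\<rparr>) (cost m d)
        ((sem w b m d (?s\<lparr>pc := off + 2\<rparr>))\<lparr>pc := off + 2 + code_len d\<rparr>)"
      using IfLe.IH(2)[OF _ rdy d1] IfLe.prems by simp
    have 4: "reaches P w ((sem w b m d (?s\<lparr>pc := off + 2\<rparr>))\<lparr>pc := off + 2 + code_len d\<rparr>) (Suc 0)
        ((sem w b m d (?s\<lparr>pc := off + 2\<rparr>))\<lparr>pc := ?e\<rparr>)"
      using d2 by (intro reaches_exec[where i = "Jump ?e"]) auto
    have "reaches P w s (cost m (IfLe x y c d))
        ((sem w b m d (?s\<lparr>pc := off + 2\<rparr>))\<lparr>pc := ?e\<rparr>)"
      by (rule reaches_mono[OF reaches_trans[OF 1 reaches_trans[OF 2 reaches_trans[OF 3 4]]]]) simp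
    then show ?thesis using False by (simp add: Let_def ac_simps sem_pc del: fun_upd_apply)
  qed
next
  case (For x c)
  from For.prems have x: "8 \<le> x" "x \<notin> writes c" "wf_com c" by auto
  let ?e = "off + 8 + code_len c"
  let ?s0 = "s\<lparr>mem := (mem s)(x := b)\<rparr>"
  \<comment> \<open>The configuration after \<open>n\<close> rounds, up to \<open>pc\<close>. By
    \<open>pos\<close> below, the position cell tells how many rounds are left, so no separate
    counter is needed.\<close>
  define st where "st n = fold (\<lambda>i. sem w b m c \<circ> enter w b m x i) [0..<n] ?s0" for n
  have st_0: "st 0 = ?s0" by (simp add: st_def)
  have st_Suc: "st (Suc n) = sem w b m c (enter w b m x n (st n))" for n
    by (simp add: st_def)
  from For.prems have "code_at P off (Sub x BASE ZERO # Sub TMP END x # JumpZero TMP ?e #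
      Read (Suc x) x # Add x x ONE # Read (Suc (Suc x)) x # Add x x ONE #
      compile (off + 7) c @ [Jump (off + 1)])" (is "code_at P off (?i0 # ?c0)") by simp
  note at0 = this and at1 = this[THEN code_at_Cons, THEN conjunct2, THEN conjunct2]
  note at2 = at1[THEN code_at_Cons, THEN conjunct2, THEN conjunct2]
  note at3 = at2[THEN code_at_Cons, THEN conjunct2, THEN conjunct2]
  note at4 = at3[THEN code_at_Cons, THEN conjunct2, THEN conjunct2]
  note at5 = at4[THEN code_at_Cons, THEN conjunct2, THEN conjunct2]
  note at6 = at5[THEN code_at_Cons, THEN conjunct2, THEN conjunct2]
  note at7 = at6[THEN code_at_Cons, THEN conjunct2, THEN conjunct2]
  have body_at: "code_at P (off + 7) (compile (off + 7) c)"
    and jump_at: "code_at P (off + 7 + code_len c) [Jump (off + 1)]"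
    using at7[THEN code_at_append] by (auto simp: eval_nat_numeral)
  have rdy: "ready b m (st n)" for n
    using For.prems x by (induction n) (auto simp: st_0 st_Suc ready_sem ready_enter ready_upd)
  have pos: "mem (st n) x = b + 2 * n" for n
    using x by (induction n) (auto simp: st_0 st_Suc sem_frame)
  have iter: "reaches P w ((st n)\<lparr>pc := off + 1\<rparr>) (7 + cost m c) ((st (Suc n))\<lparr>pc := off + 1\<rparr>)"
    if "n < m" for n
  proof -
    let ?u = "st n"
    have r: "mem ?u ONE = 1" "mem ?u END = b + 2 * m" using rdy[of n] by (auto simp: ready_def)
    \<comment> \<open>The memories after the test subtraction, the first read, the first increment,
      the second read and the second increment. \<open>u5\<close> merges the two increments into the
      single update of \<open>x\<close> in \<open>enter\<close>.\<close>
    define f1 where "f1 = (mem ?u)(TMP := 2 * (m - n))"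
    define f2 where "f2 = f1(Suc x := read_word w (b + 2 * n))"
    define f3 where "f3 = f2(x := b + 2 * n + 1)"
    define f4 where "f4 = f3(Suc (Suc x) := read_word w (b + 2 * n + 1))"
    define f5 where "f5 = f4(x := b + 2 * n + 2)"
    let ?v = "\<lambda>p f. ?u\<lparr>pc := p, mem := f\<rparr>"
    have x': "x \<noteq> 0" "x \<noteq> TMP" "Suc x \<noteq> TMP" "Suc (Suc x) \<noteq> TMP" using x by auto
    have "?u\<lparr>pc := off + 1\<rparr> = ?v (off + 1) (mem ?u)" by simp
    then have r1: "reaches P w (?u\<lparr>pc := off + 1\<rparr>) (Suc 0) (?v (off + 2) f1)"
      using at1 r pos[of n]
      by (intro reaches_exec[where i = "Sub TMP END x"]) (auto simp: f1_def diff_mult_distrib2)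
    have r2: "reaches P w (?v (off + 2) f1) (Suc 0) (?v (off + 3) f1)"
      using at2 that by (intro reaches_exec[where i = "JumpZero TMP ?e"]) (auto simp: f1_def)
    have r3: "reaches P w (?v (off + 3) f1) (Suc 0) (?v (off + 4) f2)"
      using at3 pos[of n] x'
      by (intro reaches_exec[where i = "Read (Suc x) x"])
        (simp_all add: read_word_def f2_def f1_def eval_nat_numeral)
    have r4: "reaches P w (?v (off + 4) f2) (Suc 0) (?v (off + 5) f3)"
      using at4 pos[of n] x' r
      by (intro reaches_exec[where i = "Add x x ONE"]) (simp_all add: f3_def f2_def f1_def eval_nat_numeral)
    have r5: "reaches P w (?v (off + 5) f3) (Suc 0) (?v (off + 6) f4)"
      using at5 x'
      by (intro reaches_exec[where i = "Read (Suc (Suc x)) x"])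
        (simp_all add: read_word_def f4_def f3_def eval_nat_numeral)
    have r6: "reaches P w (?v (off + 6) f4) (Suc 0) (?v (off + 7) f5)"
      using at6 x' r
      by (intro reaches_exec[where i = "Add x x ONE"])
        (simp_all add: f5_def f4_def f3_def f2_def f1_def eval_nat_numeral)
    have u5: "?v p f5 = (enter w b m x n ?u)\<lparr>pc := p\<rparr>" for p
      using x' by (simp add: enter_def f5_def f4_def f3_def f2_def f1_def fun_upd_twist)
    have r7: "reaches P w (?v (off + 7) f5) (cost m c)
        ((st (Suc n))\<lparr>pc := off + 7 + code_len c\<rparr>)"
      unfolding u5 using For.IH[OF x(3) _ body_at, of "(enter w b m x n ?u)\<lparr>pc := off + 7\<rparr>"]
        x(1) rdy[of n] ready_enter[of x b m w n ?u]
      by (simp add: ready_def st_Suc sem_pc del: enter_simps)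
    have r8: "reaches P w ((st (Suc n))\<lparr>pc := off + 7 + code_len c\<rparr>) (Suc 0) ((st (Suc n))\<lparr>pc := off + 1\<rparr>)"
      using jump_at by (intro reaches_exec[where i = "Jump (off + 1)"]) auto
    have "reaches P w (?u\<lparr>pc := off + 1\<rparr>)
        (Suc 0 + (Suc 0 + (Suc 0 + (Suc 0 + (Suc 0 + (Suc 0 + (cost m c + Suc 0)))))))
        ((st (Suc n))\<lparr>pc := off + 1\<rparr>)"
      by (intro reaches_trans[OF r1] reaches_trans[OF r2] reaches_trans[OF r3] reaches_trans[OF r4]
        reaches_trans[OF r5] reaches_trans[OF r6] reaches_trans[OF r7] r8)
    then show ?thesis by (rule reaches_mono) simp
  qed
  have loop: "reaches P w (?s0\<lparr>pc := off + 1\<rparr>) (n * (7 + cost m c)) ((st n)\<lparr>pc := off + 1\<rparr>)"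
    if "n \<le> m" for n
    using that
  proof (induction n)
    case 0
    then show ?case by (simp add: st_0 reaches_refl del: fun_upd_apply)
  next
    case (Suc n)
    have "reaches P w (?s0\<lparr>pc := off + 1\<rparr>) (n * (7 + cost m c) + (7 + cost m c)) ((st (Suc n))\<lparr>pc := off + 1\<rparr>)"
      using Suc iter[of n] by (intro reaches_trans[OF Suc.IH]) auto
    then show ?case by (rule reaches_mono) simp
  qed
  let ?u = "st m"
  let ?u1 = "?u\<lparr>mem := (mem ?u)(TMP := 0)\<rparr>"
  have r: "mem ?u END = b + 2 * m" using rdy[of m] by (auto simp: ready_def)
  have 1: "reaches P w s (Suc 0) (?s0\<lparr>pc := off + 1\<rparr>)"
    using at0 For.prems by (intro reaches_exec[where i = "Sub x BASE ZERO"]) (auto simp: ready_def)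
  have 2: "reaches P w (?u\<lparr>pc := off + 1\<rparr>) (Suc 0) (?u1\<lparr>pc := off + 2\<rparr>)"
    using at1 r pos[of m] by (intro reaches_exec[where i = "Sub TMP END x"]) auto
  have 3: "reaches P w (?u1\<lparr>pc := off + 2\<rparr>) (Suc 0) (?u1\<lparr>pc := ?e\<rparr>)"
    using at2 by (intro reaches_exec[where i = "JumpZero TMP ?e"]) auto
  have "reaches P w s (Suc 0 + (m * (7 + cost m c) + (Suc 0 + Suc 0))) (?u1\<lparr>pc := ?e\<rparr>)"
    by (rule reaches_trans[OF 1 reaches_trans[OF loop[OF order_refl] reaches_trans[OF 2 3]]])
  then show ?case by (simp add: Let_def st_def ac_simps eval_nat_numeral)
qed

section \<open>The kernelization program\<close>

abbreviation (input) "P_AT \<equiv> 10 :: nat"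
abbreviation (input) "P_U \<equiv> 11 :: nat"
abbreviation (input) "P_V \<equiv> 12 :: nat"
abbreviation (input) "Q_AT \<equiv> 13 :: nat"
abbreviation (input) "Q_U \<equiv> 14 :: nat"
abbreviation (input) "Q_V \<equiv> 15 :: nat"
abbreviation (input) "R_AT \<equiv> 16 :: nat"
abbreviation (input) "R_U \<equiv> 17 :: nat"
abbreviation (input) "R_V \<equiv> 18 :: nat"
abbreviation (input) "J_AT \<equiv> 19 :: nat"
abbreviation (input) "J_U \<equiv> 20 :: nat"
abbreviation (input) "J_V \<equiv> 21 :: nat"
abbreviation (input) "A_AT \<equiv> 22 :: nat"
abbreviation (input) "A_U \<equiv> 23 :: nat"
abbreviation (input) "A_V \<equiv> 24 :: nat"
abbreviation (input) "DEG_U \<equiv> 25 :: nat"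
abbreviation (input) "DEG_V \<equiv> 26 :: nat"
abbreviation (input) "RANK_U \<equiv> 27 :: nat"
abbreviation (input) "RANK_V \<equiv> 28 :: nat"
abbreviation (input) "LOW \<equiv> 29 :: nat"
abbreviation (input) "KEEP \<equiv> 30 :: nat"
abbreviation (input) "Q_DEG_U \<equiv> 31 :: nat"
abbreviation (input) "Q_DEG_V \<equiv> 32 :: nat"
abbreviation (input) "CNT \<equiv> 33 :: nat"
abbreviation (input) "CNT2 \<equiv> 34 :: nat"
abbreviation (input) "BOUND \<equiv> 35 :: nat"
abbreviation (input) "LAB \<equiv> 36 :: nat"
abbreviation (input) "TARGET \<equiv> 37 :: nat"
abbreviation (input) "POS \<equiv> 38 :: nat"

definition if_eq :: "nat \<Rightarrow> nat \<Rightarrow> com \<Rightarrow> com" where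
  "if_eq a b c = IfLe a b (IfLe b a c Skip) Skip"

definition degrees_com :: com where
  "degrees_com =
     SetTo Q_DEG_U 0 ;; SetTo Q_DEG_V 0 ;;
     For R_AT
      (if_eq R_U Q_U (Inc Q_DEG_U) ;; if_eq R_V Q_U (Inc Q_DEG_U) ;;
       if_eq R_U Q_V (Inc Q_DEG_V) ;; if_eq R_V Q_V (Inc Q_DEG_V))"

text \<open>\<open>d\<close> and \<open>r\<close> are the degree and rank counters of the end of the
  candidate edge at which the scanned edge was found. Position cells serve as edge numbers, so
  \<open>Q_AT < A_AT\<close> means an earlier edge.\<close>

definition meet_com :: "nat \<Rightarrow> nat \<Rightarrow> com" where
  "meet_com d r =
     Inc d ;; IfLe A_AT Q_AT Skip (Inc r) ;;
     IfLe Q_DEG_U PAR2 (IfLe Q_DEG_V PAR2 (SetTo LOW 1) Skip) Skip"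

text \<open>The candidate edge is passed in the \<open>A\<close> cells, so that the same test serves
  both the \<open>P\<close> loops and the \<open>J\<close> loop of \<open>label_com\<close>.\<close>

definition keep_com :: com where
  "keep_com =
     SetTo DEG_U 0 ;; SetTo DEG_V 0 ;; SetTo RANK_U 0 ;; SetTo RANK_V 0 ;; SetTo LOW 0 ;;
     For Q_AT
      (degrees_com ;;
       if_eq Q_U A_U (meet_com DEG_U RANK_U) ;; if_eq Q_V A_U (meet_com DEG_U RANK_U) ;;
       if_eq Q_U A_V (meet_com DEG_V RANK_V) ;; if_eq Q_V A_V (meet_com DEG_V RANK_V)) ;;
     SetTo KEEP 0 ;;
     IfLe DEG_U PAR2 Skip (IfLe DEG_V PAR2 Skip (SetTo KEEP 1)) ;;
     IfLe ONE LOW (SetTo KEEP 1) Skip ;;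
     IfLe RANK_U PAR2 (IfLe RANK_V PAR2 (SetTo KEEP 1) Skip) Skip"

definition for_kept :: "nat \<Rightarrow> com \<Rightarrow> com" where
  "for_kept x c = For x
     (Copy A_AT x ;; Copy A_U (Suc x) ;; Copy A_V (Suc (Suc x)) ;; keep_com ;; IfLe ONE KEEP c Skip)"

definition label_com :: com where
  "label_com = SetTo LAB 0 ;; SetTo POS 0 ;;
     for_kept J_AT (if_eq J_U TARGET (Copy LAB POS) ;; Inc POS ;; if_eq J_V TARGET (Copy LAB POS) ;; Inc POS)"

primrec add_times :: "nat \<Rightarrow> com" where
  "add_times 0 = Skip"
| "add_times (Suc n) = AddTo BOUND PAR ;; add_times n"

text \<open>Multiplication is replaced by two loops over the edges whose counters stop at
  \<open>k\<close>, so \<open>26 * k\<close> is added \<open>k * k\<close> times. There are enough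
  edges for this because \<open>kernel_com\<close> treats the case \<open>m \<le> k\<close>
  beforehand.\<close>

definition bound_com :: com where
  "bound_com = SetTo BOUND 0 ;; SetTo CNT 0 ;;
     For P_AT (IfLe PAR CNT Skip (Inc CNT ;; SetTo CNT2 0 ;;
       For Q_AT (IfLe PAR CNT2 Skip (Inc CNT2 ;; add_times 26))))"

text \<open>A graph with at most \<open>k\<close> edges is a yes-instance and is replaced by the empty graph. If there is a
  solution, at most \<open>2k (8k\<^sup>2 + 4k + 1) \<le> 26 k\<^sup>3\<close> edges are kept; if more are kept, a single edge with
  parameter 0 is returned. The kernel has two vertices per kept edge, some of them isolated.\<close>

definition kernel_com :: com where
  "kernel_com =
     IfLe EDGES PAR (Put ZERO ;; Put ZERO ;; Put ZERO)
      (bound_com ;;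
       SetTo CNT 0 ;; SetTo CNT2 0 ;; for_kept P_AT (Inc CNT ;; Inc CNT2 ;; Inc CNT2) ;;
       IfLe CNT BOUND
        (Put PAR ;; Put CNT2 ;;
         SetTo POS 0 ;; for_kept P_AT (Put POS ;; Inc POS ;; Put POS ;; Inc POS) ;;
         Put CNT ;;
         for_kept P_AT (Copy TARGET P_U ;; label_com ;; Put LAB ;; Copy TARGET P_V ;; label_com ;; Put LAB))
        (SetTo LAB 2 ;; Put ZERO ;; Put LAB ;; Put ZERO ;; Put ONE ;; Put ONE ;; Put ZERO ;; Put ONE))"

lemmas com_defs = if_eq_def degrees_com_def meet_com_def keep_com_def for_kept_def label_com_def
  bound_com_def kernel_com_def

lemma add_times:
  "wf_com (add_times n)" "depth (add_times n) = 0" "silent (add_times n)"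
  "writes (add_times n) \<subseteq> {BOUND}"
  by (induction n) auto

lemma writes_add_times: "a \<noteq> BOUND \<Longrightarrow> a \<notin> writes (add_times n)"
  using add_times(4) by blast

lemma sem_add_times: "sem w b m (add_times n) s =
    s\<lparr>mem := (mem s)(BOUND := mem s BOUND + n * mem s PAR)\<rparr>"
  by (induction n arbitrary: s) (auto simp: algebra_simps)

lemma wf_kernel_com: "wf_com kernel_com"
  by (simp add: com_defs add_times writes_add_times)

lemma depth_kernel_com: "depth kernel_com = 4"
  by (simp add: com_defs add_times)

subsection \<open>Semantics\<close>

lemma sem_if_eq_other:
  "y \<noteq> TMP \<Longrightarrow> y \<notin> writes c \<Longrightarrow> mem (sem w b m (if_eq a d c) s) y = mem s y"
  by (rule sem_frame) (auto simp: if_eq_def)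

lemma sem_if_eq_Inc:
  "y \<noteq> TMP \<Longrightarrow> a \<noteq> TMP \<Longrightarrow> d \<noteq> TMP \<Longrightarrow> e \<noteq> TMP \<Longrightarrow>
    mem (sem w b m (if_eq a d (Inc e)) s) y =
      mem s y + of_bool (y = e \<and> mem s a = mem s d)"
  by (auto simp: if_eq_def Let_def)

lemma sem_if_eq_Copy:
  "y \<noteq> TMP \<Longrightarrow> a \<noteq> TMP \<Longrightarrow> d \<noteq> TMP \<Longrightarrow> e \<noteq> TMP \<Longrightarrow> f \<noteq> TMP \<Longrightarrow>
    mem (sem w b m (if_eq a d (Copy e f)) s) y =
      (if y = e \<and> mem s a = mem s d then mem s f else mem s y)"
  by (auto simp: if_eq_def Let_def)

lemma sem_meet_com:
  assumes "y \<noteq> TMP" "d \<in> {DEG_U, DEG_V}" "r \<in> {RANK_U, RANK_V}"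
  shows "mem (sem w b m (meet_com d r) s) y =
      (if y = LOW \<and> mem s Q_DEG_U \<le> mem s PAR2 \<and> mem s Q_DEG_V \<le> mem s PAR2 then 1
       else mem s y + of_bool (y = d \<or> y = r \<and> mem s Q_AT < mem s A_AT))"
proof -
  have "d \<notin> {3,6,13,22,29,31,32}" "r \<notin> {3,6,13,22,29,31,32}" "d \<noteq> r" using assms by auto
  with \<open>y \<noteq> TMP\<close> show ?thesis by (simp add: meet_com_def Let_def)
qed

lemma sem_if_eq_meet:
  assumes "y \<noteq> TMP" "a \<noteq> TMP" "c \<noteq> TMP" "d \<in> {DEG_U, DEG_V}" "r \<in> {RANK_U, RANK_V}"
  shows "mem (sem w b m (if_eq a c (meet_com d r)) s) y =
      (if mem s a = mem s c then
         (if y = LOW \<and> mem s Q_DEG_U \<le> mem s PAR2 \<and> mem s Q_DEG_V \<le> mem s PAR2 then 1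
          else mem s y + of_bool (y = d \<or> y = r \<and> mem s Q_AT < mem s A_AT))
       else mem s y)"
  unfolding if_eq_def using assms(1-3) by (simp add: Let_def sem_meet_com[OF assms(1,4,5)])

text \<open>Only the layout of the edge list is fixed here, so the program is analysed for arbitrary
  pairs; loops and repeated edges are excluded later, in \<open>edge_graph\<close>.\<close>

locale edge_list =
  fixes w :: "nat list" and b m k :: nat and eu ev :: "nat \<Rightarrow> nat"
  assumes eu: "\<And>i. i < m \<Longrightarrow> read_word w (b + 2 * i) = eu i"
    and ev: "\<And>i. i < m \<Longrightarrow> read_word w (Suc (b + 2 * i)) = ev i"
begin

abbreviation "run \<equiv> sem w b m"

definition occ :: "nat \<Rightarrow> nat \<Rightarrow> nat" where
  "occ a i = of_bool (eu i = a) + of_bool (ev i = a)"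

definition degree :: "nat \<Rightarrow> nat" where
  "degree a = (\<Sum>i<m. occ a i)"

definition rank :: "nat \<Rightarrow> nat \<Rightarrow> nat" where
  "rank a i = (\<Sum>j<i. occ a j)"

definition low_edge :: "nat \<Rightarrow> bool" where
  "low_edge i \<longleftrightarrow> degree (eu i) \<le> 2 * k \<and> degree (ev i) \<le> 2 * k"

definition meets :: "nat \<Rightarrow> nat \<Rightarrow> bool" where
  "meets i j \<longleftrightarrow> eu j \<in> {eu i, ev i} \<or> ev j \<in> {eu i, ev i}"

text \<open>The rank clause treats both ends alike, so that it need not know which one is high: an
  end that is not high has rank at most its degree, hence at most \<open>2 * k\<close>, and only the
  rank at a high end can violate the clause. The edge \<open>j\<close> met by \<open>i\<close> may
  be \<open>i\<close> itself.\<close>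

definition keep :: "nat \<Rightarrow> bool" where
  "keep i \<longleftrightarrow> 2 * k < degree (eu i) \<and> 2 * k < degree (ev i) \<or>
     (\<exists>j<m. low_edge j \<and> meets i j) \<or>
     rank (eu i) i \<le> 2 * k \<and> rank (ev i) i \<le> 2 * k"

definition set_up :: "config \<Rightarrow> bool" where
  "set_up s \<longleftrightarrow> mem s ONE = 1 \<and> mem s PAR = k \<and> mem s EDGES = m \<and> mem s PAR2 = 2 * k \<and>
     mem s BASE = b \<and> mem s END = b + 2 * m \<and> mem s ZERO = 0"

lemma set_up_frame: "\<forall>y. y \<notin> W \<longrightarrow> mem s' y = mem s y \<Longrightarrow> W \<inter> {0,1,2,3,4,5,7} = {} \<Longrightarrow>
    set_up s' = set_up s"
  by (auto simp: set_up_def)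

lemma set_up_sem: "wf_com c \<Longrightarrow> set_up (run c s) = set_up s"
  by (rule set_up_frame[of "writes c"]) (use wf_writes[of c] in \<open>force simp: sem_frame\<close>)+

lemma degrees_com:
  "mem (run degrees_com s) Q_DEG_U = degree (mem s Q_U) \<and>
   mem (run degrees_com s) Q_DEG_V = degree (mem s Q_V)"
proof -
  define s0 where "s0 = run (SetTo Q_DEG_U 0 ;; SetTo Q_DEG_V 0) s"
  let ?c = "if_eq R_U Q_U (Inc Q_DEG_U) ;; if_eq R_V Q_U (Inc Q_DEG_U) ;;
       if_eq R_U Q_V (Inc Q_DEG_V) ;; if_eq R_V Q_V (Inc Q_DEG_V)"
  have "mem (run (For R_AT ?c) s0) Q_DEG_U = degree (mem s Q_U) \<and>
   mem (run (For R_AT ?c) s0) Q_DEG_V = degree (mem s Q_V)"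
  proof (rule For_rule[where I = "\<lambda>i (t :: config). mem t Q_DEG_U = (\<Sum>j<i. occ (mem s Q_U) j) \<and>
      mem t Q_DEG_V = (\<Sum>j<i. occ (mem s Q_V) j)"])
    fix i and t :: config assume i: "i < m" and fr: "\<forall>y. y \<notin> writes (For R_AT ?c) \<longrightarrow> mem t y = mem s0 y"
      and I: "mem t Q_DEG_U = (\<Sum>j<i. occ (mem s Q_U) j) \<and>
      mem t Q_DEG_V = (\<Sum>j<i. occ (mem s Q_V) j)"
    have fr': "mem t Q_U = mem s Q_U" "mem t Q_V = mem s Q_V"
      using fr by (auto simp: if_eq_def s0_def)
    let ?t = "enter w b m R_AT i t"
    have e: "mem ?t R_U = eu i" "mem ?t R_V = ev i"
      using i eu ev enter_simps(4)[of w b m R_AT i t] enter_simps(5)[of w b m R_AT i t] by auto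
    show "mem (run ?c ?t) Q_DEG_U = (\<Sum>j<Suc i. occ (mem s Q_U) j) \<and>
      mem (run ?c ?t) Q_DEG_V = (\<Sum>j<Suc i. occ (mem s Q_V) j)"
      by (simp add: sem_if_eq_Inc e fr' I occ_def)
  qed (auto simp: degree_def s0_def)
  then show ?thesis by (simp add: degrees_com_def s0_def)
qed

lemma keep_com:
  assumes "p < m" "set_up s" "mem s A_AT = b + 2 * p + 2" "mem s A_U = eu p" "mem s A_V = ev p"
  shows "mem (run keep_com s) KEEP = of_bool (keep p)"
proof -
  define s0 where "s0 = run (SetTo DEG_U 0 ;; SetTo DEG_V 0 ;; SetTo RANK_U 0 ;; SetTo RANK_V 0 ;; SetTo LOW 0) s"
  let ?c = "degrees_com ;;
       if_eq Q_U A_U (meet_com DEG_U RANK_U) ;; if_eq Q_V A_U (meet_com DEG_U RANK_U) ;;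
       if_eq Q_U A_V (meet_com DEG_V RANK_V) ;; if_eq Q_V A_V (meet_com DEG_V RANK_V)"
  \<comment> \<open>The ranks stop growing at \<open>p\<close>, hence \<open>min i p\<close>: only
    edges before the candidate are counted.\<close>
  let ?I = "\<lambda>i (t :: config). mem t DEG_U = (\<Sum>j<i. occ (eu p) j) \<and> mem t DEG_V = (\<Sum>j<i. occ (ev p) j) \<and>
     mem t RANK_U = (\<Sum>j<min i p. occ (eu p) j) \<and> mem t RANK_V = (\<Sum>j<min i p. occ (ev p) j) \<and>
     mem t LOW = of_bool (\<exists>j<i. low_edge j \<and> meets p j)"
  have loop: "?I m (run (For Q_AT ?c) s0)"
  proof (rule For_rule[where I = ?I])
    fix i and t :: config assume i: "i < m" and fr: "\<forall>y. y \<notin> writes (For Q_AT ?c) \<longrightarrow> mem t y = mem s0 y"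
      and I: "?I i t"
    have fr': "mem t A_U = eu p" "mem t A_V = ev p" "mem t A_AT = b + 2 * p + 2" "mem t PAR2 = 2 * k"
      using fr assms by (auto simp: com_defs s0_def set_up_def)
    let ?t = "run degrees_com (enter w b m Q_AT i t)"
    have e: "mem (enter w b m Q_AT i t) Q_U = eu i" "mem (enter w b m Q_AT i t) Q_V = ev i"
      using i eu ev enter_simps(4)[of w b m Q_AT i t] enter_simps(5)[of w b m Q_AT i t] by auto
    have d: "mem ?t y = mem (enter w b m Q_AT i t) y" if "y \<notin> {6,16,17,18,31,32}" for y
      by (rule sem_frame) (use that in \<open>auto simp: degrees_com_def if_eq_def\<close>)
    \<comment> \<open>What the four \<open>meet_com\<close> blocks read besides their counters. None
      of them writes it, so \<open>F\<close> passes through all four and their joint effect on the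
      counters can be simplified at once.\<close>
    define F where "F u \<longleftrightarrow> mem u Q_DEG_U = degree (eu i) \<and> mem u Q_DEG_V = degree (ev i) \<and>
      mem u Q_U = eu i \<and> mem u Q_V = ev i \<and> mem u A_U = eu p \<and> mem u A_V = ev p \<and>
      mem u A_AT = b + 2 * p + 2 \<and> mem u PAR2 = 2 * k \<and> mem u Q_AT = b + 2 * i + 2" for u :: config
    have F0: "F ?t"
      using degrees_com[of "enter w b m Q_AT i t"] unfolding F_def by (simp add: e d fr')
    have t: "mem ?t DEG_U = mem t DEG_U" "mem ?t DEG_V = mem t DEG_V" "mem ?t RANK_U = mem t RANK_U"
      "mem ?t RANK_V = mem t RANK_V" "mem ?t LOW = mem t LOW"
      by (simp_all add: d)
    have F_step: "F (run (if_eq a c (meet_com x y)) u)"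
      if "F u" "x \<in> {DEG_U, DEG_V}" "y \<in> {RANK_U, RANK_V}" for a c x y u
      using that unfolding F_def
      by (subst sem_if_eq_other; simp add: meet_com_def; auto)+
    have step: "mem (run (if_eq a c (meet_com x r)) u) y =
      (if mem u a = mem u c then
         (if y = LOW \<and> low_edge i then 1 else mem u y + of_bool (y = x \<or> y = r \<and> i < p))
       else mem u y)"
      if "F u" "y \<noteq> TMP" "a \<noteq> TMP" "c \<noteq> TMP" "x \<in> {DEG_U, DEG_V}" "r \<in> {RANK_U, RANK_V}" for a c x y r u
      using that unfolding F_def by (subst sem_if_eq_meet) (auto simp: low_edge_def)
    have F_vals: "mem u Q_U = eu i" "mem u Q_V = ev i" "mem u A_U = eu p" "mem u A_V = ev p" if "F u" for u
      using that by (auto simp: F_def)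
    have r: "(\<Sum>j<min (Suc i) p. occ a j) = (\<Sum>j<min i p. occ a j) + (if i < p then occ a i else 0)" for a
      by (cases "i < p") (auto simp: min_def le_Suc_eq)
    have l: "(\<exists>j<Suc i. low_edge j \<and> meets p j) \<longleftrightarrow> (\<exists>j<i. low_edge j \<and> meets p j) \<or>
        (low_edge i \<and>
         (eu i = eu p \<or> ev i = eu p \<or> eu i = ev p \<or> ev i = ev p))"
      by (auto simp: less_Suc_eq meets_def)
    show "?I (Suc i) (run ?c (enter w b m Q_AT i t))"
      unfolding r l using I
      by (simp add: step F_step F_vals F0 t occ_def del: sum.lessThan_Suc)
         (simp add: occ_def)
  qed (auto simp: s0_def)
  define t where "t = run (For Q_AT ?c) s0"
  have fr: "mem t PAR2 = 2 * k" "mem t ONE = 1"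
  proof -
    have "mem t y = mem s0 y" if "y \<in> {PAR2, ONE}" for y
      unfolding t_def by (rule sem_frame) (use that in \<open>auto simp: com_defs\<close>)
    then show "mem t PAR2 = 2 * k" "mem t ONE = 1"
      using assms by (auto simp: s0_def set_up_def)
  qed
  have eq: "run keep_com s = run (SetTo KEEP 0 ;;
     IfLe DEG_U PAR2 Skip (IfLe DEG_V PAR2 Skip (SetTo KEEP 1)) ;;
     IfLe ONE LOW (SetTo KEEP 1) Skip ;;
     IfLe RANK_U PAR2 (IfLe RANK_V PAR2 (SetTo KEEP 1) Skip) Skip) t"
    by (simp add: keep_com_def t_def s0_def)
  have tail: "mem (run keep_com s) KEEP = of_bool (2 * k < mem t DEG_U \<and> 2 * k < mem t DEG_V \<or>
      1 \<le> mem t LOW \<or> mem t RANK_U \<le> 2 * k \<and> mem t RANK_V \<le> 2 * k)"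
    unfolding eq by (simp add: Let_def fr)
  have "mem t DEG_U = degree (eu p)" "mem t DEG_V = degree (ev p)" "mem t RANK_U = rank (eu p) p"
    "mem t RANK_V = rank (ev p) p" "1 \<le> mem t LOW \<longleftrightarrow> (\<exists>j<m. low_edge j \<and> meets p j)"
    using loop \<open>p < m\<close> by (simp_all add: t_def degree_def rank_def)
  then show ?thesis unfolding tail keep_def by presburger
qed

end

section \<open>Enumeration of the kept edges, vertex labels and the output\<close>

lemma writes_keep_com: "writes keep_com = {TMP,13,14,15,16,17,18,25,26,27,28,29,30,31,32}"
  by (auto simp: com_defs)

text \<open>The last occurrence is taken because \<open>label_com\<close> overwrites
  \<open>LAB\<close> at every hit. For absent elements the truncated subtraction yields 0, the
  initial value of \<open>LAB\<close>.\<close>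

definition last_pos :: "'a \<Rightarrow> 'a list \<Rightarrow> nat" where
  "last_pos a xs = length xs - 1 - length (takeWhile (\<lambda>x. x \<noteq> a) (rev xs))"

lemma last_pos_Nil [simp]: "last_pos a [] = 0"
  by (simp add: last_pos_def)

lemma last_pos_snoc [simp]: "last_pos a (xs @ [x]) = (if x = a then length xs else last_pos a xs)"
  by (simp add: last_pos_def)

lemma last_pos: "a \<in> set xs \<Longrightarrow> last_pos a xs < length xs \<and> xs ! last_pos a xs = a"
  by (induction xs rule: rev_induct) (auto simp: nth_append)

context edge_list
begin

definition kept :: "nat \<Rightarrow> nat list" where
  "kept i = filter keep [0..<i]"

definition ends :: "nat \<Rightarrow> nat list" where
  "ends i = concat (map (\<lambda>j. [eu j, ev j]) (kept i))"

definition label :: "nat \<Rightarrow> nat" where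
  "label a = last_pos a (ends m)"

lemma kept_Suc: "kept (Suc i) = kept i @ (if keep i then [i] else [])"
  by (simp add: kept_def)

lemma ends_Suc: "ends (Suc i) = ends i @ (if keep i then [eu i, ev i] else [])"
  by (simp add: ends_def kept_Suc)

lemma kept_0 [simp]: "kept 0 = []" and ends_0 [simp]: "ends 0 = []"
  by (simp_all add: kept_def ends_def)

lemma length_ends: "length (ends i) = 2 * length (kept i)"
  by (induction i) (auto simp: kept_Suc ends_Suc)

text \<open>Cells that may change between the entry of the body of \<open>for_kept x\<close> and the start of its
  inner command.\<close>

definition scratch :: "nat \<Rightarrow> nat set" where
  "scratch x = {TMP, x, Suc x, Suc (Suc x)} \<union> {13,14,15,16,17,18,22,23,24,25,26,27,28,29,30,31,32}"

text \<open>The inner command starts in a state \<open>t\<close> reached after the keep test, so two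
  frames are offered: \<open>t\<close> agrees with the initial \<open>s\<close> on cells that the
  whole loop leaves alone, and with the state \<open>s'\<close> of the invariant outside the scratch
  cells. The \<open>Q\<close> and \<open>R\<close> cells serve the test itself, hence only
  \<open>P\<close> and \<open>J\<close> loops qualify.\<close>

lemma for_kept_rule:
  assumes x: "x \<in> {P_AT, J_AT}" and s: "set_up s" and c: "wf_com c"
    and init: "\<And>s'. outp s' = outp s \<Longrightarrow> \<forall>y. y \<noteq> x \<longrightarrow> mem s' y = mem s y \<Longrightarrow> I 0 s'"
    and body: "\<And>i s' t. i < m \<Longrightarrow> keep i \<Longrightarrow> I i s' \<Longrightarrow>
      \<forall>y. y \<notin> writes (for_kept x c) \<longrightarrow> mem t y = mem s y \<Longrightarrow>
      outp t = outp s' \<Longrightarrow> \<forall>y. y \<notin> scratch x \<longrightarrow> mem t y = mem s' y \<Longrightarrow>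
      mem t (Suc x) = eu i \<Longrightarrow> mem t (Suc (Suc x)) = ev i \<Longrightarrow> I (Suc i) (run c t)"
    and skip: "\<And>i s' t. i < m \<Longrightarrow> \<not> keep i \<Longrightarrow> I i s' \<Longrightarrow>
      outp t = outp s' \<Longrightarrow> \<forall>y. y \<notin> scratch x \<longrightarrow> mem t y = mem s' y \<Longrightarrow> I (Suc i) t"
    and final: "\<And>s'. I m s' \<Longrightarrow> Q (s'\<lparr>mem := (mem s')(TMP := 0)\<rparr>)"
  shows "Q (run (for_kept x c) s)"
proof -
  let ?c = "Copy A_AT x ;; Copy A_U (Suc x) ;; Copy A_V (Suc (Suc x)) ;; keep_com ;; IfLe ONE KEEP c Skip"
  have wr: "writes (for_kept x c) = writes (For x ?c)" by (simp add: for_kept_def)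
  show ?thesis unfolding for_kept_def
  proof (rule For_rule[where I = I and Q = Q])
    fix i and s' :: config
    assume i: "i < m" and fr: "\<forall>y. y \<notin> writes (For x ?c) \<longrightarrow> mem s' y = mem s y" and I: "I i s'"
    let ?e = "enter w b m x i s'"
    define t0 where "t0 = run (Copy A_AT x ;; Copy A_U (Suc x) ;; Copy A_V (Suc (Suc x))) ?e"
    define t1 where "t1 = run keep_com t0"
    define t where "t = t1\<lparr>mem := (mem t1)(TMP := mem t1 ONE - mem t1 KEEP)\<rparr>"
    have t0_other: "mem t0 y = mem s' y" if "y \<notin> {TMP, x, Suc x, Suc (Suc x), A_AT, A_U, A_V}" for y
      using that by (simp add: t0_def)
    have t1_other: "mem t1 y = mem t0 y" if "y \<notin> {TMP,13,14,15,16,17,18,25,26,27,28,29,30,31,32}" for y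
      unfolding t1_def by (rule sem_frame) (use that in \<open>simp add: writes_keep_com\<close>)
    have t_other: "\<forall>y. y \<notin> scratch x \<longrightarrow> mem t y = mem s' y"
    proof (intro allI impI)
      fix y assume y: "y \<notin> scratch x"
      then have "mem t y = mem t1 y" by (simp add: t_def scratch_def)
      also have "\<dots> = mem t0 y" by (rule t1_other) (use y in \<open>auto simp: scratch_def\<close>)
      also have "\<dots> = mem s' y" by (rule t0_other) (use y in \<open>auto simp: scratch_def\<close>)
      finally show "mem t y = mem s' y" .
    qed
    have t0_vals: "mem t0 A_AT = b + 2 * i + 2" "mem t0 A_U = eu i" "mem t0 A_V = ev i"
      "mem t0 (Suc x) = eu i" "mem t0 (Suc (Suc x)) = ev i"
      using x i eu ev by (auto simp: t0_def enter_def)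
    have "set_up s'"
    proof -
      have "writes (For x ?c) \<inter> {0,1,2,3,4,5,7} = {}"
        using x by (auto simp: writes_keep_com dest: wf_writes[OF c])
      then have "set_up s' = set_up s" by (rule set_up_frame[OF fr])
      with s show ?thesis by simp
    qed
    then have "set_up t0" using x by (auto simp: set_up_def t0_other)
    then have keep: "mem t1 KEEP = of_bool (keep i)"
      unfolding t1_def using keep_com[OF i _ t0_vals(1-3)] by blast
    have "set_up t1" using \<open>set_up t0\<close> by (auto simp: set_up_def t1_other)
    then have one: "mem t1 ONE = 1" by (simp add: set_up_def)
    have o: "outp t = outp s'"
    proof -
      have "silent keep_com" by (simp add: com_defs)
      then show ?thesis by (simp add: t_def t1_def t0_def sem_silent)
    qed
    have uv: "mem t (Suc x) = eu i" "mem t (Suc (Suc x)) = ev i"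
      using x t0_vals by (auto simp: t_def t1_other)
    have "run ?c ?e = run (IfLe ONE KEEP c Skip) t1" by (simp add: t1_def t0_def)
    also have "\<dots> = (if keep i then run c t else t)"
      using keep one by (simp add: Let_def t_def)
    finally have eq: "run ?c ?e = (if keep i then run c t else t)" .
    have fr_t: "\<forall>y. y \<notin> writes (for_kept x c) \<longrightarrow> mem t y = mem s y"
    proof (intro allI impI)
      fix y assume y: "y \<notin> writes (for_kept x c)"
      have "y \<notin> scratch x"
        using y x by (auto simp: for_kept_def writes_keep_com scratch_def)
      with t_other fr y wr show "mem t y = mem s y" by auto
    qed
    show "I (Suc i) (run ?c ?e)"
    proof (cases "keep i")
      case True
      then show ?thesis using body[OF i True I fr_t o t_other uv] unfolding eq by simp
    next
      case False
      then show ?thesis using skip[OF i False I o t_other] unfolding eq by simp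
    qed
  qed (use init final in blast)+
qed

lemma count_kept:
  assumes "set_up s" "mem s CNT = 0" "mem s CNT2 = 0"
  shows "mem (run (for_kept P_AT (Inc CNT ;; Inc CNT2 ;; Inc CNT2)) s) CNT = length (kept m) \<and>
    mem (run (for_kept P_AT (Inc CNT ;; Inc CNT2 ;; Inc CNT2)) s) CNT2 = 2 * length (kept m)"
  by (rule for_kept_rule[where I = "\<lambda>i t. mem t CNT = length (kept i) \<and> mem t CNT2 = 2 * length (kept i)"])
    (use assms in \<open>auto simp: kept_Suc scratch_def\<close>)

lemma put_vertices:
  assumes "set_up s" "mem s POS = 0"
  shows "outp (run (for_kept P_AT (Put POS ;; Inc POS ;; Put POS ;; Inc POS)) s) =
    outp s @ [0..<2 * length (kept m)]"
  by (rule for_kept_rule[where I = "\<lambda>i t. mem t POS = 2 * length (kept i) \<and>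
      outp t = outp s @ [0..<2 * length (kept i)]"])
    (use assms in \<open>auto simp: kept_Suc scratch_def\<close>)

lemma label_com:
  assumes "set_up s"
  shows "mem (run label_com s) LAB = label (mem s TARGET)"
proof -
  define s0 where "s0 = run (SetTo LAB 0 ;; SetTo POS 0) s"
  let ?c = "if_eq J_U TARGET (Copy LAB POS) ;; Inc POS ;; if_eq J_V TARGET (Copy LAB POS) ;; Inc POS"
  let ?I = "\<lambda>i t. mem t POS = length (ends i) \<and> mem t LAB = last_pos (mem s TARGET) (ends i)"
  have "?I m (run (for_kept J_AT ?c) s0)"
  proof (rule for_kept_rule[where I = ?I])
    show "set_up s0" using assms by (simp add: s0_def set_up_def)
    show "wf_com ?c" by (simp add: if_eq_def)
    fix i and s' t :: config
    assume "i < m" "keep i" and I: "?I i s'"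
      and fr: "\<forall>y. y \<notin> writes (for_kept J_AT ?c) \<longrightarrow> mem t y = mem s0 y"
      and sc: "\<forall>y. y \<notin> scratch J_AT \<longrightarrow> mem t y = mem s' y"
      and uv: "mem t (Suc J_AT) = eu i" "mem t (Suc (Suc J_AT)) = ev i"
    have "mem t TARGET = mem s TARGET"
      using fr by (simp add: for_kept_def writes_keep_com if_eq_def s0_def)
    moreover have "mem t POS = mem s' POS" "mem t LAB = mem s' LAB" using sc by (auto simp: scratch_def)
    moreover have "mem t J_U = eu i" "mem t J_V = ev i" using uv by simp_all
    moreover have "ends (Suc i) = (ends i @ [eu i]) @ [ev i]" using \<open>keep i\<close> by (simp add: ends_Suc)
    ultimately show "?I (Suc i) (run ?c t)"
      using I unfolding \<open>ends (Suc i) = _\<close> last_pos_snoc by (simp add: sem_if_eq_Copy)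
  qed (auto simp: s0_def scratch_def ends_Suc)
  then show ?thesis by (simp add: label_com_def s0_def label_def)
qed

lemma writes_label_com: "writes label_com =
    {TMP,13,14,15,16,17,18,19,20,21,22,23,24,25,26,27,28,29,30,31,32,36,38}"
  by (auto simp: label_com_def for_kept_def if_eq_def writes_keep_com)

lemma silent_label_com: "silent label_com"
  by (simp add: com_defs)

lemma wf_label_com: "wf_com label_com"
  by (simp add: com_defs)

text \<open>\<open>label_com\<close> overwrites the \<open>A\<close> cells in its own loop but
  leaves the \<open>P\<close> cells alone, so the second end is still available after the first
  label has been computed.\<close>

lemma put_edges:
  assumes "set_up s"
  shows "outp (run (for_kept P_AT (Copy TARGET P_U ;; label_com ;; Put LAB ;;
      Copy TARGET P_V ;; label_com ;; Put LAB)) s) =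
    outp s @ concat (map (\<lambda>j. [label (eu j), label (ev j)]) (kept m))" (is "outp (run (for_kept P_AT ?c) s) = _")
proof (rule for_kept_rule[where I = "\<lambda>i t. outp t = outp s @ concat (map (\<lambda>j. [label (eu j), label (ev j)]) (kept i))"])
  show "wf_com ?c" by (simp add: wf_label_com)
  fix i and s' t :: config
  assume "i < m" "keep i" and I: "outp s' = outp s @ concat (map (\<lambda>j. [label (eu j), label (ev j)]) (kept i))"
    and fr: "\<forall>y. y \<notin> writes (for_kept P_AT ?c) \<longrightarrow> mem t y = mem s y"
    and o: "outp t = outp s'"
    and uv: "mem t (Suc P_AT) = eu i" "mem t (Suc (Suc P_AT)) = ev i"
  have "writes (for_kept P_AT ?c) \<inter> {0,1,2,3,4,5,7} = {}"
    by (simp add: for_kept_def writes_label_com writes_keep_com)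
  with assms have t: "set_up t" using set_up_frame[OF fr] by blast
  have set_up_target: "set_up (u\<lparr>mem := (mem u)(TARGET := v)\<rparr>) = set_up u" for u v
    by (simp add: set_up_def)
  define t1 where "t1 = run (Copy TARGET P_U ;; label_com) t"
  have t1: "set_up t1" "mem t1 LAB = label (eu i)" "mem t1 P_V = ev i" "outp t1 = outp s'"
    using t label_com[of "t\<lparr>mem := (mem t)(TARGET := mem t P_U)\<rparr>"] uv o
    by (simp_all add: t1_def set_up_sem wf_label_com set_up_target sem_silent silent_label_com
        sem_frame writes_label_com del: fun_upd_apply) (simp_all add: uv)
  define t2 where "t2 = run (Put LAB ;; Copy TARGET P_V ;; label_com) t1"
  have "set_up (t1\<lparr>outp := v\<rparr>) = set_up t1" for v by (simp add: set_up_def)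
  then have t2: "mem t2 LAB = label (ev i)" "outp t2 = outp s' @ [label (eu i)]"
    using t1 label_com[of "t1\<lparr>outp := outp s' @ [label (eu i)], mem := (mem t1)(TARGET := ev i)\<rparr>"]
    set_up_target[of "t1\<lparr>outp := outp s' @ [label (eu i)]\<rparr>" "ev i"]
    by (simp_all add: t2_def sem_silent silent_label_com del: fun_upd_apply) simp
  have "run ?c t = run (Put LAB) t2" by (simp add: t1_def t2_def)
  with t2 I \<open>keep i\<close> show "outp (run ?c t) =
      outp s @ concat (map (\<lambda>j. [label (eu j), label (ev j)]) (kept (Suc i)))"
    by (simp add: kept_Suc)
qed (use assms in \<open>auto simp: kept_Suc\<close>)

lemma bound_com:
  assumes "set_up s" "k < m"
  shows "mem (run bound_com s) BOUND = 26 * k ^ 3"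
proof -
  define s0 where "s0 = run (SetTo BOUND 0 ;; SetTo CNT 0) s"
  let ?d = "IfLe PAR CNT2 Skip (Inc CNT2 ;; add_times 26)"
  let ?c = "IfLe PAR CNT Skip (Inc CNT ;; SetTo CNT2 0 ;; For Q_AT ?d)"
  have inner: "mem (run (For Q_AT ?d) u) BOUND = mem u BOUND + 26 * k * k"
    if u: "mem u PAR = k" "mem u CNT2 = 0" for u
  proof -
    have "mem (run (For Q_AT ?d) u) CNT2 = min m k \<and>
        mem (run (For Q_AT ?d) u) BOUND = mem u BOUND + 26 * k * min m k"
    proof (rule For_rule[where I = "\<lambda>i t. mem t CNT2 = min i k \<and> mem t BOUND = mem u BOUND + 26 * k * min i k"])
      fix i and t :: config
      assume fr: "\<forall>y. y \<notin> writes (For Q_AT ?d) \<longrightarrow> mem t y = mem u y"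
        and I: "mem t CNT2 = min i k \<and> mem t BOUND = mem u BOUND + 26 * k * min i k"
      have "mem t PAR = k" using fr u by (simp add: writes_add_times)
      with I show "mem (run ?d (enter w b m Q_AT i t)) CNT2 = min (Suc i) k \<and>
          mem (run ?d (enter w b m Q_AT i t)) BOUND = mem u BOUND + 26 * k * min (Suc i) k"
        by (simp add: Let_def sem_add_times min_def algebra_simps)
    qed (use u in auto)
    with \<open>k < m\<close> show ?thesis by simp
  qed
  have "mem (run (For P_AT ?c) s0) CNT = min m k \<and>
      mem (run (For P_AT ?c) s0) BOUND = 26 * k * k * min m k"
  proof (rule For_rule[where I = "\<lambda>i t. mem t CNT = min i k \<and> mem t BOUND = 26 * k * k * min i k"])
    fix i and t :: config
    assume fr: "\<forall>y. y \<notin> writes (For P_AT ?c) \<longrightarrow> mem t y = mem s0 y"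
      and I: "mem t CNT = min i k \<and> mem t BOUND = 26 * k * k * min i k"
    have par: "mem t PAR = k" using fr assms by (simp add: writes_add_times s0_def set_up_def)
    show "mem (run ?c (enter w b m P_AT i t)) CNT = min (Suc i) k \<and>
        mem (run ?c (enter w b m P_AT i t)) BOUND = 26 * k * k * min (Suc i) k"
    proof (cases "k \<le> i")
      case True
      then show ?thesis using I par by (simp add: Let_def)
    next
      case False
      define u where "u = run (Inc CNT ;; SetTo CNT2 0) ((enter w b m P_AT i t)\<lparr>mem :=
        (mem (enter w b m P_AT i t))(TMP := k - i)\<rparr>)"
      have "run ?c (enter w b m P_AT i t) = run (For Q_AT ?d) u"
        using False I par by (simp add: Let_def u_def)
      moreover have "mem u PAR = k" "mem u CNT2 = 0" "mem u CNT = Suc i" "mem u BOUND = 26 * k * k * i"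
        using False I par by (simp_all add: u_def)
      moreover have "mem (run (For Q_AT ?d) u) CNT = mem u CNT"
        by (rule sem_frame) (simp add: writes_add_times)
      ultimately show ?thesis using False inner[of u] by (simp add: algebra_simps)
    qed
  qed (auto simp: s0_def)
  with \<open>k < m\<close> show ?thesis by (simp add: bound_com_def s0_def power3_eq_cube)
qed

definition kernel_output :: "nat list" where
  "kernel_output =
     (if m \<le> k then [0, 0, 0]
      else if length (kept m) \<le> 26 * k ^ 3 then
        [k, 2 * length (kept m)] @ [0..<2 * length (kept m)] @ [length (kept m)] @
        concat (map (\<lambda>j. [label (eu j), label (ev j)]) (kept m))
      else [0, 2, 0, 1, 1, 0, 1])"

lemma kernel_com:
  assumes s: "set_up s" "outp s = []"
  shows "outp (run kernel_com s) = kernel_output"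
proof (cases "m \<le> k")
  case True
  then show ?thesis using s by (simp add: kernel_com_def kernel_output_def Let_def set_up_def)
next
  case False
  let ?cnt = "for_kept P_AT (Inc CNT ;; Inc CNT2 ;; Inc CNT2)"
  let ?vs = "for_kept P_AT (Put POS ;; Inc POS ;; Put POS ;; Inc POS)"
  let ?es = "for_kept P_AT (Copy TARGET P_U ;; label_com ;; Put LAB ;; Copy TARGET P_V ;; label_com ;; Put LAB)"
  define s1 where "s1 = s\<lparr>mem := (mem s)(TMP := m - k)\<rparr>"
  define s2 where "s2 = run bound_com s1"
  define s3 where "s3 = run (SetTo CNT 0 ;; SetTo CNT2 0) s2"
  define s4 where "s4 = run ?cnt s3"
  have wf: "wf_com bound_com" "wf_com ?cnt" "wf_com ?vs" "wf_com ?es"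
    using wf_kernel_com by (simp_all add: kernel_com_def)
  have upd: "set_up (u\<lparr>mem := (mem u)(a := v)\<rparr>) = set_up u" if "a = TMP \<or> 8 \<le> a" for u a v
    using that by (auto simp: set_up_def)
  have upd_o: "set_up (u\<lparr>outp := v\<rparr>) = set_up u" for u v by (simp add: set_up_def)
  have s1: "set_up s1" using s by (simp add: s1_def upd)
  have s2: "set_up s2" "mem s2 BOUND = 26 * k ^ 3"
    using s1 False wf by (simp_all add: s2_def set_up_sem bound_com)
  have s3: "set_up s3" "mem s3 BOUND = 26 * k ^ 3" "mem s3 CNT = 0" "mem s3 CNT2 = 0"
    using s2 by (simp_all add: s3_def set_up_def)
  have "mem s4 BOUND = mem s3 BOUND"
    unfolding s4_def by (rule sem_frame) (simp add: for_kept_def writes_keep_com)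
  then have s4: "set_up s4" "mem s4 BOUND = 26 * k ^ 3" "mem s4 CNT = length (kept m)"
    "mem s4 CNT2 = 2 * length (kept m)"
    using s3 count_kept[of s3] wf by (simp_all add: s4_def set_up_sem)
  have o4: "outp s4 = []"
  proof -
    have "silent bound_com" "silent ?cnt" by (simp_all add: com_defs add_times)
    then show ?thesis using s by (simp add: s4_def s3_def s2_def s1_def sem_silent)
  qed
  define s5 where "s5 = s4\<lparr>mem := (mem s4)(TMP := length (kept m) - 26 * k ^ 3)\<rparr>"
  have s5: "set_up s5" "outp s5 = []" "mem s5 CNT = length (kept m)" "mem s5 CNT2 = 2 * length (kept m)"
    using s4 o4 by (simp_all add: s5_def upd del: fun_upd_apply) simp_all
  have c: "mem s PAR = k" "mem s EDGES = m" using s by (auto simp: set_up_def)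
  have eq: "run kernel_com s = (if length (kept m) \<le> 26 * k ^ 3
      then run (Put PAR ;; Put CNT2 ;; SetTo POS 0 ;; ?vs ;; Put CNT ;; ?es) s5
      else run (SetTo LAB 2 ;; Put ZERO ;; Put LAB ;; Put ZERO ;; Put ONE ;; Put ONE ;; Put ZERO ;; Put ONE) s5)"
    unfolding kernel_com_def sem.simps(8) c using False s4(2,3)
    by (simp only: sem.simps Let_def if_False s1_def[symmetric] s2_def[symmetric])
      (simp only: sem.simps s3_def[unfolded sem.simps, symmetric] s4_def[symmetric] Let_def s4 s5_def[symmetric])
  show ?thesis
  proof (cases "length (kept m) \<le> 26 * k ^ 3")
    case True
    define s6 where "s6 = run (Put PAR ;; Put CNT2 ;; SetTo POS 0) s5"
    have s6: "set_up s6" "outp s6 = [k, 2 * length (kept m)]" "mem s6 POS = 0" "mem s6 CNT = length (kept m)"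
      using s5 by (auto simp: s6_def set_up_def)
    define s7 where "s7 = run ?vs s6"
    have "mem s7 CNT = mem s6 CNT"
      unfolding s7_def by (rule sem_frame) (simp add: for_kept_def writes_keep_com)
    then have s7: "set_up s7" "outp s7 = [k, 2 * length (kept m)] @ [0..<2 * length (kept m)]"
      "mem s7 CNT = length (kept m)"
      using s6 wf put_vertices[of s6] by (simp_all add: s7_def set_up_sem)
    define s8 where "s8 = run (Put CNT) s7"
    have s8: "set_up s8" "outp s8 = [k, 2 * length (kept m)] @ [0..<2 * length (kept m)] @ [length (kept m)]"
      using s7 by (simp_all add: s8_def set_up_def)
    have "run kernel_com s = run ?es s8"
      using True eq by (simp add: s8_def s7_def s6_def)
    then show ?thesis using put_edges[OF s8(1)] s8(2) True False by (simp add: kernel_output_def)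
  next
    case F: False
    then show ?thesis using False s5 unfolding eq by (simp add: kernel_output_def set_up_def)
  qed
qed

end

section \<open>The kernel of Edge Dominating Set\<close>

text \<open>An edge of \<open>S\<close> meets itself, being nonempty; so solutions are the sets of
  edges whose ends form a vertex cover. All later arguments use this form.\<close>

lemma edge_dominating_set_iff:
  assumes "{} \<notin> E"
  shows "edge_dominating_set E S \<longleftrightarrow> S \<subseteq> E \<and> (\<forall>e\<in>E. e \<inter> \<Union>S \<noteq> {})"
proof -
  have meet: "(\<exists>f\<in>S. e \<inter> f \<noteq> {}) \<longleftrightarrow> e \<inter> \<Union>S \<noteq> {}" for e by blast
  have "e \<inter> \<Union>S \<noteq> {}" if "e \<in> S" "S \<subseteq> E" for e
  proof -
    have "e \<noteq> {}" using that assms by blast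
    then show ?thesis using that(1) by blast
  qed
  then show ?thesis unfolding edge_dominating_set_def meet by auto
qed

lemma card_Union_edges_le:
  assumes "\<And>e. e \<in> S \<Longrightarrow> card e = 2" "finite S"
  shows "finite (\<Union>S)" "card (\<Union>S) \<le> 2 * card S"
proof -
  have "finite e" if "e \<in> S" for e using assms(1)[OF that] by (simp add: card_ge_0_finite)
  then show "finite (\<Union>S)" using assms(2) by blast
  have "card (\<Union>S) \<le> (\<Sum>e\<in>S. card e)" by (rule card_Union_le_sum_card)
  also have "\<dots> = 2 * card S" using assms(1) by simp
  finally show "card (\<Union>S) \<le> 2 * card S" .
qed

lemma card_2_with: "card e = 2 \<Longrightarrow> a \<in> e \<Longrightarrow> \<exists>c. e = {a, c} \<and> c \<noteq> a"
  by (auto simp: card_2_iff)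

text \<open>If a vertex is not covered, all its neighbours are.\<close>

lemma high_degree_covered:
  assumes E: "\<And>e. e \<in> E \<Longrightarrow> card e = 2" and S: "edge_dominating_set E S" "finite S" "card S \<le> k"
    and deg: "2 * k < card {e \<in> E. v \<in> e}"
  shows "v \<in> \<Union>S"
proof (rule ccontr)
  assume v: "v \<notin> \<Union>S"
  have ne: "{} \<notin> E" using E by force
  have S': "S \<subseteq> E" "\<And>e. e \<in> E \<Longrightarrow> e \<inter> \<Union>S \<noteq> {}"
    using S(1) unfolding edge_dominating_set_iff[OF ne] by auto
  have fin: "finite (\<Union>S)" "card (\<Union>S) \<le> 2 * card S"
    using card_Union_edges_le[of S] E S S' by auto
  have "{e \<in> E. v \<in> e} \<subseteq> (\<lambda>c. {v, c}) ` \<Union>S"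
  proof
    fix e assume "e \<in> {e \<in> E. v \<in> e}"
    then have e: "e \<in> E" "v \<in> e" by auto
    obtain c where "e = {v, c}" using card_2_with[OF E[OF e(1)] e(2)] by blast
    moreover have "e \<inter> \<Union>S \<noteq> {}" using S'(2) e(1) by blast
    ultimately have "c \<in> \<Union>S" using v by blast
    with \<open>e = {v, c}\<close> show "e \<in> (\<lambda>c. {v, c}) ` \<Union>S" by blast
  qed
  then have "card {e \<in> E. v \<in> e} \<le> card (\<Union>S)" using fin(1) by (rule surj_card_le[rotated])
  with fin S(3) deg show False by linarith
qed

text \<open>\<open>H\<close> stands for the high vertices, with degrees measured in
  \<open>E'\<close>. This forces \<open>H\<close> to be covered by the solutions of either graph,
  since degrees in \<open>E\<close> are at least as large.\<close>

lemma edge_dominating_set_kernel: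
  assumes fin: "finite E" and E: "\<And>e. e \<in> E \<Longrightarrow> card e = 2" and sub: "E' \<subseteq> E"
    and high: "\<And>h. h \<in> H \<Longrightarrow> 2 * k < card {e \<in> E'. h \<in> e}"
    and dropped: "\<And>e. e \<in> E - E' \<Longrightarrow>
      \<exists>h v. e = {h, v} \<and> h \<in> H \<and> v \<notin> H \<and> (\<forall>f\<in>E. v \<in> f \<longrightarrow> f \<inter> H \<noteq> {})"
  shows "(\<exists>S. edge_dominating_set E S \<and> card S \<le> k) \<longleftrightarrow> (\<exists>S. edge_dominating_set E' S \<and> card S \<le> k)"
proof
  have ne: "{} \<notin> E" using E by force
  have ne': "{} \<notin> E'" using ne sub by blast
  {
    assume "\<exists>S. edge_dominating_set E S \<and> card S \<le> k"
    then obtain S where S: "edge_dominating_set E S" "card S \<le> k" by blast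
    then have S': "S \<subseteq> E" "\<And>e. e \<in> E \<Longrightarrow> e \<inter> \<Union>S \<noteq> {}"
      unfolding edge_dominating_set_iff[OF ne] by auto
    have finS: "finite S" using S'(1) fin finite_subset by blast
    \<comment> \<open>Choice of the replacement \<open>r e\<close>: kept edges stay, and a dropped
      edge is exchanged for a kept edge at its high end, which exists because that end has positive
      degree in \<open>E'\<close>.\<close>
    have "\<exists>f. f \<in> E' \<and> (e \<in> E' \<longrightarrow> f = e) \<and> e \<inter> H \<subseteq> f" if "e \<in> S" for e
    proof (cases "e \<in> E'")
      case False
      with that S' obtain h v where e: "e = {h, v}" "h \<in> H" "v \<notin> H" using dropped by blast
      then have "{f \<in> E'. h \<in> f} \<noteq> {}" using high[OF e(2)] by (metis card.empty not_less_zero)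
      with e False show ?thesis by blast
    qed blast
    then obtain r where r: "\<And>e. e \<in> S \<Longrightarrow> r e \<in> E'" "\<And>e. e \<in> S \<Longrightarrow> e \<in> E' \<Longrightarrow> r e = e"
      "\<And>e. e \<in> S \<Longrightarrow> e \<inter> H \<subseteq> r e" by metis
    have H: "H \<subseteq> \<Union>(r ` S)"
    proof
      fix h assume h: "h \<in> H"
      have "{e \<in> E'. h \<in> e} \<subseteq> {e \<in> E. h \<in> e}" "finite {e \<in> E. h \<in> e}" using sub fin by auto
      then have "2 * k < card {e \<in> E. h \<in> e}"
        using high[OF h] card_mono[of "{e \<in> E. h \<in> e}" "{e \<in> E'. h \<in> e}"] by linarith
      then have "h \<in> \<Union>S" using high_degree_covered[OF E S(1) finS S(2)] by blast
      with h r(3) show "h \<in> \<Union>(r ` S)" by blast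
    qed
    have "e \<inter> \<Union>(r ` S) \<noteq> {}" if "e \<in> E'" for e
    proof (cases "e \<inter> H = {}")
      case True
      \<comment> \<open>The edge \<open>e\<close> avoids \<open>H\<close>. If the edge
        \<open>f\<close> dominating it was dropped, the two share the end \<open>v\<close> of
        \<open>f\<close>; but every edge at \<open>v\<close> meets \<open>H\<close>, a
        contradiction.\<close>
      from S'(2)[of e] that sub obtain x f where x: "x \<in> e" "x \<in> f" "f \<in> S" by blast
      show ?thesis
      proof (cases "f \<in> E'")
        case True
        with x r(2) show ?thesis by blast
      next
        case False
        with x S' obtain h v where f: "f = {h, v}" "h \<in> H" "\<forall>f\<in>E. v \<in> f \<longrightarrow> f \<inter> H \<noteq> {}"
          using dropped[of f] by blast
        from x True f(1,2) have "x = v" by blast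
        then show ?thesis using f(3) x(1) that sub True by blast
      qed
    qed (use H in blast)
    then have "edge_dominating_set E' (r ` S)"
      unfolding edge_dominating_set_iff[OF ne'] using r(1) by blast
    moreover have "card (r ` S) \<le> k" using card_image_le[OF finS, of r] S(2) by simp
    ultimately show "\<exists>S. edge_dominating_set E' S \<and> card S \<le> k" by blast
  }
  assume "\<exists>S. edge_dominating_set E' S \<and> card S \<le> k"
  then obtain S where S: "edge_dominating_set E' S" "card S \<le> k" by blast
  then have S': "S \<subseteq> E'" "\<And>e. e \<in> E' \<Longrightarrow> e \<inter> \<Union>S \<noteq> {}"
    unfolding edge_dominating_set_iff[OF ne'] by auto
  have "finite S" using S'(1) sub fin by (meson finite_subset)
  then have H: "H \<subseteq> \<Union>S" using high_degree_covered[OF _ S(1) _ S(2)] high E sub by blast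
  have "e \<inter> \<Union>S \<noteq> {}" if e: "e \<in> E" for e
  proof (cases "e \<in> E'")
    case False
    then obtain h v where "e = {h, v}" "h \<in> H" using e dropped[of e] by blast
    with H show ?thesis by blast
  qed (rule S'(2))
  then have "edge_dominating_set E S"
    unfolding edge_dominating_set_iff[OF ne] using S'(1) sub by blast
  with S(2) show "\<exists>S. edge_dominating_set E S \<and> card S \<le> k" by blast
qed

lemma card_UN_le_mult:
  assumes "finite A" "card A \<le> p" "\<And>a. a \<in> A \<Longrightarrow> card (f a) \<le> q"
  shows "card (\<Union>a\<in>A. f a) \<le> p * (q :: nat)"
proof -
  have "card (\<Union>a\<in>A. f a) \<le> (\<Sum>a\<in>A. card (f a))" using assms(1) by (rule card_UN_le)
  also have "\<dots> \<le> (\<Sum>a\<in>A. q)" using assms(3) by (rule sum_mono)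
  also have "\<dots> \<le> p * q" using assms(2) by simp
  finally show ?thesis .
qed

text \<open>\<open>R h\<close> abstracts the edges kept for their low rank at \<open>h\<close>, so
  that the estimate can be made without reference to the order of the edges.\<close>

lemma card_kernel_le:
  assumes fin: "finite E" and E: "\<And>e. e \<in> E \<Longrightarrow> card e = 2" and sub: "E' \<subseteq> E"
    and S: "edge_dominating_set E S" "card S \<le> k"
    and H: "H \<subseteq> \<Union>S"
    and low: "\<And>v. v \<notin> H \<Longrightarrow> card {e \<in> E. v \<in> e} \<le> 2 * k"
    and kept: "\<And>e h. e \<in> E' \<Longrightarrow> h \<in> e \<Longrightarrow> h \<in> H \<Longrightarrow>
      e \<subseteq> H \<or> (\<exists>f\<in>E. f \<inter> H = {} \<and> e \<inter> f \<noteq> {}) \<or> e \<in> R h"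
    and R: "\<And>h. h \<in> H \<Longrightarrow> finite (R h) \<and> card (R h) \<le> 2 * k + 1"
  shows "card E' \<le> 26 * k ^ 3"
proof -
  have ne: "{} \<notin> E" using E by force
  have S': "S \<subseteq> E" "\<And>e. e \<in> E \<Longrightarrow> e \<inter> \<Union>S \<noteq> {}"
    using S(1) unfolding edge_dominating_set_iff[OF ne] by auto
  have finS: "finite S" using S'(1) fin finite_subset by blast
  let ?U = "\<Union>S"
  have U: "finite ?U" "card ?U \<le> 2 * k"
  proof -
    have "\<And>e. e \<in> S \<Longrightarrow> card e = 2" using E S'(1) by blast
    from card_Union_edges_le[OF this finS] S(2) show "finite ?U" "card ?U \<le> 2 * k" by auto
  qed
  \<comment> \<open>An edge disjoint from \<open>H\<close> is covered at a vertex of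
    \<open>?U - H\<close>, so \<open>W\<close> contains all ends of such edges. There are at most
    \<open>2 * k\<close> choices of \<open>x\<close>, at most \<open>2 * k\<close> edges at each,
    and two ends per edge.\<close>
  define W where "W = (\<Union>x\<in>?U - H. \<Union>{f \<in> E. x \<in> f})"
  have W: "card W \<le> 2 * k * (2 * (2 * k))"
    unfolding W_def
  proof (rule card_UN_le_mult)
    show "finite (?U - H)" using U by simp
    show "card (?U - H) \<le> 2 * k" using U card_mono[of ?U "?U - H"] by auto
    fix x assume "x \<in> ?U - H"
    then have "card {f \<in> E. x \<in> f} \<le> 2 * k" using low by blast
    moreover have "card (\<Union>{f \<in> E. x \<in> f}) \<le> 2 * card {f \<in> E. x \<in> f}"
      by (rule card_Union_edges_le) (use E fin in auto)
    ultimately show "card (\<Union>{f \<in> E. x \<in> f}) \<le> 2 * (2 * k)" by linarith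
  qed
  have finW: "finite W"
  proof -
    have "finite (\<Union>{f \<in> E. x \<in> f})" for x by (rule card_Union_edges_le) (use E fin in auto)
    then show ?thesis unfolding W_def using U by blast
  qed
  have "E' \<subseteq> (\<Union>a\<in>?U. {e \<in> E'. a \<in> e})" using S'(2) sub by blast
  moreover have "finite E'" using sub fin finite_subset by blast
  ultimately have "card E' \<le> card (\<Union>a\<in>?U. {e \<in> E'. a \<in> e})"
    using finite_UN_I[OF U(1), of "\<lambda>a. {e \<in> E'. a \<in> e}"] by (intro card_mono) auto
  \<comment> \<open>At a vertex of \<open>H\<close>: \<open>2 * k\<close> edges with other end in
    \<open>?U\<close>, \<open>8 * k * k\<close> with other end in \<open>W\<close>, and
    \<open>2 * k + 1\<close> from \<open>R\<close>.\<close>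
  also have "\<dots> \<le> 2 * k * (8 * k * k + 4 * k + 1)"
  proof (rule card_UN_le_mult[OF U])
    fix a assume a: "a \<in> ?U"
    show "card {e \<in> E'. a \<in> e} \<le> 8 * k * k + 4 * k + 1"
    proof (cases "a \<in> H")
      case False
      have "card {e \<in> E'. a \<in> e} \<le> card {e \<in> E. a \<in> e}"
        by (rule card_mono) (use fin sub in auto)
      with low[OF False] show ?thesis by linarith
    next
      case True
      have "{e \<in> E'. a \<in> e} \<subseteq> (\<lambda>c. {a, c}) ` (?U \<union> W) \<union> R a"
      proof
        fix e assume "e \<in> {e \<in> E'. a \<in> e}"
        then have e: "e \<in> E'" "a \<in> e" by auto
        then obtain c where c: "e = {a, c}" using card_2_with[OF E] sub by blast
        consider "e \<subseteq> H" | f where "f \<in> E" "f \<inter> H = {}" "e \<inter> f \<noteq> {}" | "e \<in> R a"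
          using kept[OF e True] by blast
        then show "e \<in> (\<lambda>c. {a, c}) ` (?U \<union> W) \<union> R a"
        proof cases
          case 1
          with c H show ?thesis by blast
        next
          case 2
          with c True have "c \<in> f" by blast
          moreover obtain x where "x \<in> f" "x \<in> ?U" using S'(2)[OF 2(1)] by blast
          ultimately have "c \<in> W" using 2 unfolding W_def by blast
          with c show ?thesis by blast
        qed simp
      qed
      moreover have "finite ((\<lambda>c. {a, c}) ` (?U \<union> W) \<union> R a)" using U finW R[OF True] by blast
      ultimately have "card {e \<in> E'. a \<in> e} \<le> card ((\<lambda>c. {a, c}) ` (?U \<union> W) \<union> R a)"
        by (rule card_mono[rotated])
      also have "\<dots> \<le> card ((\<lambda>c. {a, c}) ` (?U \<union> W)) + card (R a)" by (rule card_Un_le)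
      also have "card ((\<lambda>c. {a, c}) ` (?U \<union> W)) \<le> card (?U \<union> W)"
        using U finW by (intro card_image_le) blast
      also have "card (?U \<union> W) \<le> card ?U + card W" by (rule card_Un_le)
      finally show ?thesis using U(2) W R[OF True] by (simp add: algebra_simps)
    qed
  qed
  also have "\<dots> \<le> 26 * k ^ 3"
  proof (cases k)
    case (Suc n)
    then show ?thesis by (simp add: power3_eq_cube algebra_simps)
  qed simp
  finally show ?thesis .
qed

text \<open>Images of meeting edges meet, and taking images does not increase the number of edges.
  Applied to a renaming and to its inverse, this gives both directions of the next lemma.\<close>

lemma edge_dominating_set_image:
  assumes E: "{} \<notin> E" and fin: "finite E" and S: "edge_dominating_set E S" "card S \<le> k"
  shows "\<exists>S. edge_dominating_set ((`) f ` E) S \<and> card S \<le> k"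
proof (intro exI conjI)
  have E': "{} \<notin> (`) f ` E" using E by blast
  have S': "S \<subseteq> E" "\<And>e. e \<in> E \<Longrightarrow> e \<inter> \<Union>S \<noteq> {}"
    using S(1) unfolding edge_dominating_set_iff[OF E] by auto
  show "edge_dominating_set ((`) f ` E) ((`) f ` S)"
    unfolding edge_dominating_set_iff[OF E'] using S' by blast
  have "finite S" using S'(1) fin finite_subset by blast
  then show "card ((`) f ` S) \<le> k" using S(2) card_image_le le_trans by blast
qed

lemma edge_dominating_set_inj_image:
  assumes E: "{} \<notin> E" and fin: "finite E" and inj: "inj_on f (\<Union>E)"
  shows "(\<exists>S. edge_dominating_set ((`) f ` E) S \<and> card S \<le> k) \<longleftrightarrow>
    (\<exists>S. edge_dominating_set E S \<and> card S \<le> k)"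
proof
  let ?g = "inv_into (\<Union>E) f"
  assume "\<exists>S. edge_dominating_set ((`) f ` E) S \<and> card S \<le> k"
  then obtain S where "edge_dominating_set ((`) f ` E) S" "card S \<le> k" by blast
  then have "\<exists>S. edge_dominating_set ((`) ?g ` (`) f ` E) S \<and> card S \<le> k"
    using E fin by (intro edge_dominating_set_image[of "(`) f ` E" S]) auto
  moreover have "?g ` f ` e = e" if "e \<in> E" for e
    using inv_into_image_cancel[OF inj Union_upper[OF that]] .
  then have "(`) ?g ` (`) f ` E = E" by (simp add: image_image)
  ultimately show "\<exists>S. edge_dominating_set E S \<and> card S \<le> k" by simp
qed (use edge_dominating_set_image[OF E fin] in blast)

section \<open>Ranks in a finite set of natural numbers\<close>

lemma bij_betw_rank:
  fixes A :: "nat set"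
  assumes "finite A"
  shows "bij_betw (\<lambda>i. card {j \<in> A. j < i}) A {..<card A}"
proof -
  have mono: "card {j \<in> A. j < i} < card {j \<in> A. j < i'}" if "i \<in> A" "i < i'" for i i'
    using that assms by (intro psubset_card_mono) auto
  have inj: "inj_on (\<lambda>i. card {j \<in> A. j < i}) A"
  proof (rule linorder_inj_onI')
    fix i i' assume "i \<in> A" "i < i'"
    from mono[OF this] show "card {j \<in> A. j < i} \<noteq> card {j \<in> A. j < i'}" by simp
  qed
  moreover have "(\<lambda>i. card {j \<in> A. j < i}) ` A \<subseteq> {..<card A}"
    using assms by (auto intro!: psubset_card_mono)
  ultimately show ?thesis
    unfolding bij_betw_def by (simp add: card_image card_subset_eq)
qed

text \<open>Ranks run through \<open>0, ..., card A - 1\<close> without repetition, so rank at most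
  \<open>d\<close> singles out the first \<open>d + 1\<close> elements, or all if there are
  fewer.\<close>

lemma card_low_rank:
  fixes A :: "nat set"
  assumes "finite A"
  shows "card {i \<in> A. card {j \<in> A. j < i} \<le> d} = min (card A) (d + 1)"
proof -
  let ?r = "\<lambda>i. card {j \<in> A. j < i}"
  have "bij_betw ?r {i \<in> A. ?r i \<le> d} {..<min (card A) (d + 1)}"
    unfolding bij_betw_def
  proof
    show "inj_on ?r {i \<in> A. ?r i \<le> d}"
      using bij_betw_rank[OF assms] by (auto simp: bij_betw_def intro: inj_on_subset)
    have "?r ` {i \<in> A. ?r i \<le> d} = ?r ` A \<inter> {..d}" by blast
    also have "\<dots> = {..<min (card A) (d + 1)}"
      using bij_betw_rank[OF assms] by (auto simp: bij_betw_def)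
    finally show "?r ` {i \<in> A. ?r i \<le> d} = {..<min (card A) (d + 1)}" .
  qed
  then show ?thesis by (simp add: bij_betw_same_card)
qed

section \<open>Correctness of the kernel\<close>

locale edge_graph = edge_list +
  assumes loopless: "\<And>i. i < m \<Longrightarrow> eu i \<noteq> ev i"
    and simple: "inj_on (\<lambda>i. {eu i, ev i}) {..<m}"
begin

definition edge :: "nat \<Rightarrow> nat set" where
  "edge i = {eu i, ev i}"

definition edges :: "nat set set" where
  "edges = edge ` {..<m}"

definition kernel_edges :: "nat set set" where
  "kernel_edges = edge ` {i. i < m \<and> keep i}"

definition high :: "nat set" where
  "high = {v. 2 * k < degree v}"

lemma inj_edge: "inj_on edge {..<m}"
  using simple by (simp add: edge_def[abs_def])

lemma card_edge: "i < m \<Longrightarrow> card (edge i) = 2"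
  using loopless by (simp add: edge_def)

lemma finite_edges: "finite edges"
  by (simp add: edges_def)

lemma card_2_edges: "e \<in> edges \<Longrightarrow> card e = 2"
  using card_edge by (auto simp: edges_def)

lemma kernel_edges_subset: "kernel_edges \<subseteq> edges"
  by (auto simp: kernel_edges_def edges_def)

lemma card_edge_image: "I \<subseteq> {..<m} \<Longrightarrow> card (edge ` I) = card I"
  by (intro card_image inj_on_subset[OF inj_edge])

text \<open>Without loops \<open>occ a i\<close> is 0 or 1, so the sum computed by the machine
  counts edges.\<close>

lemma rank_eq: "i \<le> m \<Longrightarrow> rank a i = card {j. j < i \<and> a \<in> edge j}"
proof (induction i)
  case (Suc i)
  have "occ a i = of_bool (a \<in> edge i)"
    using loopless[of i] Suc.prems by (auto simp: occ_def edge_def)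
  moreover have "{j. j < Suc i \<and> a \<in> edge j} =
      (if a \<in> edge i then insert i {j. j < i \<and> a \<in> edge j} else {j. j < i \<and> a \<in> edge j})"
    by (auto simp: less_Suc_eq)
  ultimately show ?case using Suc by (simp add: rank_def)
qed (simp add: rank_def)

lemma degree_eq_rank: "degree a = rank a m"
  by (simp add: degree_def rank_def)

lemma degree_eq: "degree a = card {e \<in> edges. a \<in> e}"
proof -
  have "{e \<in> edges. a \<in> e} = edge ` {j. j < m \<and> a \<in> edge j}" by (auto simp: edges_def)
  then show ?thesis by (simp add: degree_eq_rank rank_eq card_edge_image subset_iff)
qed

lemma rank_le_degree: "i \<le> m \<Longrightarrow> rank a i \<le> degree a"
  unfolding degree_eq_rank rank_def by (rule sum_mono2) auto

lemma card_low_rank_edges: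
  "card {i. i < m \<and> a \<in> edge i \<and> rank a i \<le> 2 * k} = min (degree a) (2 * k + 1)"
proof -
  let ?A = "{i. i < m \<and> a \<in> edge i}"
  have "rank a i = card {j \<in> ?A. j < i}" if "i < m" for i
  proof -
    have "{j \<in> ?A. j < i} = {j. j < i \<and> a \<in> edge j}" using that by auto
    then show ?thesis using that by (simp add: rank_eq)
  qed
  then have "{i. i < m \<and> a \<in> edge i \<and> rank a i \<le> 2 * k} = {i \<in> ?A. card {j \<in> ?A. j < i} \<le> 2 * k}"
    by auto
  then show ?thesis
    using card_low_rank[of ?A "2 * k"] by (simp add: degree_eq_rank rank_eq)
qed

text \<open>If the other end is high as well, the first clause of \<open>keep\<close> applies;
  otherwise the rank of that end is bounded by its degree and the rank clause applies.\<close>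

lemma keep_low_rank:
  assumes "i < m" "a \<in> edge i" "a \<in> high" "rank a i \<le> 2 * k"
  shows "keep i"
proof -
  have le: "rank (eu i) i \<le> degree (eu i)" "rank (ev i) i \<le> degree (ev i)"
    using rank_le_degree \<open>i < m\<close> by auto
  have "a = eu i \<or> a = ev i" using assms(2) by (simp add: edge_def)
  then show ?thesis
    using assms(3,4) le unfolding keep_def high_def by auto
qed

text \<open>The first \<open>2 * k + 1\<close> edges at \<open>h\<close>, those of ranks 0 to
  \<open>2 * k\<close>, all survive. This is why ranks and degrees have the same threshold.\<close>

lemma degree_kernel:
  assumes "h \<in> high"
  shows "2 * k < card {e \<in> kernel_edges. h \<in> e}"
proof -
  let ?I = "{i. i < m \<and> h \<in> edge i \<and> rank h i \<le> 2 * k}"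
  have "edge ` ?I \<subseteq> {e \<in> kernel_edges. h \<in> e}"
    using keep_low_rank assms by (auto simp: kernel_edges_def)
  moreover have "finite kernel_edges" by (simp add: kernel_edges_def)
  ultimately have "card (edge ` ?I) \<le> card {e \<in> kernel_edges. h \<in> e}" by (intro card_mono) auto
  moreover have "card (edge ` ?I) = card ?I" by (rule card_edge_image) auto
  ultimately show ?thesis
    using assms by (simp add: card_low_rank_edges high_def)
qed

text \<open>With no high end both ranks would be at most \<open>2 * k\<close>, and with two high
  ends the first clause of \<open>keep\<close> would apply. An edge at \<open>v\<close> without high
  end would be a low edge meeting edge \<open>i\<close>.\<close>

lemma dropped_edge:
  assumes i: "i < m" "\<not> keep i"
  shows "\<exists>h v. edge i = {h, v} \<and> h \<in> high \<and> v \<notin> high \<and> (\<forall>f\<in>edges. v \<in> f \<longrightarrow> f \<inter> high \<noteq> {})"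
proof -
  have le: "rank (eu i) i \<le> degree (eu i)" "rank (ev i) i \<le> degree (ev i)"
    using rank_le_degree i by auto
  have f: "f \<inter> high \<noteq> {}" if f: "f \<in> edges" "x \<in> f" "x \<in> edge i" for f x
  proof -
    from f obtain j where j: "j < m" "f = edge j" by (auto simp: edges_def)
    with f have "meets i j" by (auto simp: meets_def edge_def)
    with i j have "\<not> low_edge j" by (auto simp: keep_def)
    with j show ?thesis by (auto simp: low_edge_def high_def edge_def)
  qed
  from i have "\<not> (2 * k < degree (eu i) \<and> 2 * k < degree (ev i))"
    "\<not> (rank (eu i) i \<le> 2 * k \<and> rank (ev i) i \<le> 2 * k)"
    by (auto simp: keep_def)
  with le consider "eu i \<in> high" "ev i \<notin> high" | "ev i \<in> high" "eu i \<notin> high"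
    by (auto simp: high_def)
  then show ?thesis
  proof cases
    case 1
    with f show ?thesis
      by (intro exI[of _ "eu i"] exI[of _ "ev i"]) (auto simp: edge_def)
  next
    case 2
    with f show ?thesis
      by (intro exI[of _ "ev i"] exI[of _ "eu i"]) (auto simp: edge_def)
  qed
qed

lemma kernel_equivalent:
  "(\<exists>S. edge_dominating_set edges S \<and> card S \<le> k) \<longleftrightarrow>
   (\<exists>S. edge_dominating_set kernel_edges S \<and> card S \<le> k)"
proof (rule edge_dominating_set_kernel[OF finite_edges card_2_edges kernel_edges_subset degree_kernel])
  fix e assume "e \<in> edges - kernel_edges"
  then obtain i where "i < m" "\<not> keep i" "e = edge i" by (auto simp: edges_def kernel_edges_def)
  then show "\<exists>h v. e = {h, v} \<and> h \<in> high \<and> v \<notin> high \<and> (\<forall>f\<in>edges. v \<in> f \<longrightarrow> f \<inter> high \<noteq> {})"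
    using dropped_edge by simp
qed

lemma set_kept: "set (kept m) = {i. i < m \<and> keep i}"
  by (auto simp: kept_def)

lemma card_kernel_edges: "card kernel_edges = length (kept m)"
proof -
  have "card kernel_edges = card (set (kept m))"
    unfolding set_kept kernel_edges_def by (rule card_edge_image) auto
  also have "\<dots> = length (kept m)" by (rule distinct_card) (simp add: kept_def)
  finally show ?thesis .
qed

lemma kernel_small:
  assumes S: "edge_dominating_set edges S" "card S \<le> k"
  shows "length (kept m) \<le> 26 * k ^ 3"
proof -
  have finS: "finite S"
    using S(1) finite_edges finite_subset by (auto simp: edge_dominating_set_def)
  have "card kernel_edges \<le> 26 * k ^ 3"
  proof (rule card_kernel_le[OF finite_edges card_2_edges kernel_edges_subset S,
        where H = high and R = "\<lambda>h. edge ` {i. i < m \<and> h \<in> edge i \<and> rank h i \<le> 2 * k}"])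
    show "high \<subseteq> \<Union>S"
      using high_degree_covered[OF card_2_edges S(1) finS S(2)] by (auto simp: high_def degree_eq)
    show "card {e \<in> edges. v \<in> e} \<le> 2 * k" if "v \<notin> high" for v
      using that by (simp add: high_def degree_eq)
    show "finite (edge ` {i. i < m \<and> h \<in> edge i \<and> rank h i \<le> 2 * k}) \<and>
        card (edge ` {i. i < m \<and> h \<in> edge i \<and> rank h i \<le> 2 * k}) \<le> 2 * k + 1" for h
    proof -
      have "card (edge ` {i. i < m \<and> h \<in> edge i \<and> rank h i \<le> 2 * k}) =
          card {i. i < m \<and> h \<in> edge i \<and> rank h i \<le> 2 * k}"
        by (rule card_edge_image) auto
      then show ?thesis by (simp add: card_low_rank_edges)
    qed
    fix e h assume "e \<in> kernel_edges" and h: "h \<in> e" "h \<in> high"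
    then obtain i where i: "i < m" "keep i" and e: "e = edge i" by (auto simp: kernel_edges_def)
    have h': "h = eu i \<or> h = ev i" using h e by (auto simp: edge_def)
    from i(2) consider "2 * k < degree (eu i)" "2 * k < degree (ev i)"
      | j where "j < m" "low_edge j" "meets i j"
      | "rank (eu i) i \<le> 2 * k" "rank (ev i) i \<le> 2 * k"
      unfolding keep_def by blast
    then show "e \<subseteq> high \<or> (\<exists>f\<in>edges. f \<inter> high = {} \<and> e \<inter> f \<noteq> {}) \<or>
        e \<in> edge ` {i. i < m \<and> h \<in> edge i \<and> rank h i \<le> 2 * k}"
    proof cases
      case 1
      then show ?thesis by (simp add: e edge_def high_def)
    next
      case 2
      then have "edge j \<in> edges" "edge j \<inter> high = {}" "e \<inter> edge j \<noteq> {}"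
        by (auto simp: edges_def low_edge_def high_def meets_def e edge_def)
      then show ?thesis by blast
    next
      case 3
      with i h h' show ?thesis by (auto simp: e)
    qed
  qed
  then show ?thesis by (simp add: card_kernel_edges)
qed

lemma set_ends: "set (ends m) = \<Union>kernel_edges"
  by (auto simp: ends_def set_kept kernel_edges_def edge_def)

text \<open>A label is a position in \<open>ends m\<close>, and the entry there gives the vertex
  back.\<close>

lemma inj_label: "inj_on label (\<Union>kernel_edges)"
  unfolding set_ends[symmetric] label_def by (rule inj_onI) (metis last_pos)

lemma label_less: "a \<in> \<Union>kernel_edges \<Longrightarrow> label a < 2 * length (kept m)"
  using last_pos[of a "ends m"] by (simp add: set_ends label_def length_ends)

lemma encodes_kernel:
  "encodes (2 * length (kept m) # [0..<2 * length (kept m)] @ length (kept m) #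
      concat (map (\<lambda>j. [label (eu j), label (ev j)]) (kept m)))
    {..<2 * length (kept m)} ((`) label ` kernel_edges)"
proof -
  let ?es = "map (\<lambda>j. (label (eu j), label (ev j))) (kept m)"
  have inj: "inj_on label e" if "e \<in> kernel_edges" for e
    using inj_label by (rule inj_on_subset) (use that in blast)
  have "card (label ` e) = 2" if "e \<in> kernel_edges" for e
    using card_image[OF inj[OF that]] card_2_edges kernel_edges_subset that by auto
  moreover have "label ` e \<subseteq> {..<2 * length (kept m)}" if "e \<in> kernel_edges" for e
    using label_less that by blast
  ultimately have "simple_graph {..<2 * length (kept m)} ((`) label ` kernel_edges)"
    by (auto simp: simple_graph_def)
  moreover have "(`) label ` kernel_edges = (\<lambda>(u, v). {u, v}) ` set ?es"
    by (simp add: kernel_edges_def set_kept edge_def image_image)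
  moreover have "inj_on ((`) label) kernel_edges"
    using inj_on_image[OF inj_label] .
  then have "length ?es = card ((`) label ` kernel_edges)"
    by (simp add: card_image card_kernel_edges)
  moreover have "concat (map (\<lambda>(u, v). [u, v]) ?es) =
      concat (map (\<lambda>j. [label (eu j), label (ev j)]) (kept m))"
    by (simp add: comp_def)
  ultimately show ?thesis unfolding encodes_def
    by (intro conjI exI[of _ "2 * length (kept m)"] exI[of _ ?es]) simp_all
qed

lemma relabelled_kernel_equivalent:
  "(\<exists>S. edge_dominating_set edges S \<and> card S \<le> k) \<longleftrightarrow>
   (\<exists>S. edge_dominating_set ((`) label ` kernel_edges) S \<and> card S \<le> k)"
proof -
  have "{} \<notin> kernel_edges" by (auto simp: kernel_edges_def edge_def)
  moreover have "finite kernel_edges" by (simp add: kernel_edges_def)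
  ultimately show ?thesis
    using edge_dominating_set_inj_image[OF _ _ inj_label] kernel_equivalent by blast
qed

end

section \<open>Encodings of graphs\<close>

lemma length_concat_pairs: "length (concat (map (\<lambda>(u, v). [u, v]) es)) = 2 * length es"
  by (induction es) auto

lemma nth_concat_pairs:
  "i < length es \<Longrightarrow> concat (map (\<lambda>(u, v). [u, v]) es) ! (2 * i) = fst (es ! i)"
  "i < length es \<Longrightarrow> concat (map (\<lambda>(u, v). [u, v]) es) ! Suc (2 * i) = snd (es ! i)"
proof (induction es arbitrary: i)
  case (Cons e es)
  { case 1
    then show ?case using Cons.IH(1)[of "i - 1"] by (cases i) (auto split: prod.split)
  next
    case 2
    then show ?case using Cons.IH(2)[of "i - 1"] by (cases i) (auto split: prod.split)
  }
qed auto

text \<open>The leading \<open>n\<close> tells where the vertex list stops, so the edge lists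
  coincide. Hence membership in \<open>EDS\<close> may be judged on any graph known to be
  encoded.\<close>

lemma encodes_unique:
  assumes "encodes x V E" "encodes x V' E'"
  shows "E = E'"
proof -
  from assms obtain n es n' es' where
    es: "E = (\<lambda>(u, v). {u, v}) ` set es" "E' = (\<lambda>(u, v). {u, v}) ` set es'" and
    eq: "n # [0..<n] @ length es # concat (map (\<lambda>(u, v). [u, v]) es) =
      n' # [0..<n'] @ length es' # concat (map (\<lambda>(u, v). [u, v]) es')"
    unfolding encodes_def by metis
  from eq have len: "length es = length es'"
    and c: "concat (map (\<lambda>(u, v). [u, v]) es) = concat (map (\<lambda>(u, v). [u, v]) es')" by auto
  have "es = es'"
  proof (rule nth_equalityI[OF len])
    fix i assume "i < length es"
    then show "es ! i = es' ! i"
      using nth_concat_pairs[of i es] nth_concat_pairs[of i es'] len c by (simp add: prod_eq_iff)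
  qed
  with es show ?thesis by simp
qed

lemma EDS_iff:
  "encodes x V E \<Longrightarrow> (x, k) \<in> EDS \<longleftrightarrow> (\<exists>S. edge_dominating_set E S \<and> card S \<le> k)"
  unfolding EDS_def using encodes_unique by blast

lemma encodes_cases:
  assumes "encodes x V E"
  obtains n es where "x = n # [0..<n] @ length es # concat (map (\<lambda>(u, v). [u, v]) es)"
    "E = (\<lambda>i. {fst (es ! i), snd (es ! i)}) ` {..<length es}" "card E = length es"
    "inj_on (\<lambda>i. {fst (es ! i), snd (es ! i)}) {..<length es}"
    "\<forall>i<length es. fst (es ! i) \<noteq> snd (es ! i)"
    "\<forall>i<length es. fst (es ! i) < n \<and> snd (es ! i) < n"
proof -
  from assms obtain n es where es: "V = {..<n}" "E = (\<lambda>(u, v). {u, v}) ` set es" "length es = card E"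
    "x = n # [0..<n] @ length es # concat (map (\<lambda>(u, v). [u, v]) es)"
    and sg: "simple_graph V E"
    unfolding encodes_def by metis
  let ?e = "\<lambda>i. {fst (es ! i), snd (es ! i)}"
  have E: "E = ?e ` {..<length es}"
  proof -
    have "set es = (!) es ` {..<length es}" by (auto simp: set_conv_nth)
    then show ?thesis unfolding es(2) by (simp add: image_image case_prod_beta)
  qed
  have e: "?e i \<subseteq> {..<n} \<and> card (?e i) = 2" if "i < length es" for i
  proof -
    have "?e i \<in> E" using that unfolding E by blast
    with sg es(1) show ?thesis unfolding simple_graph_def by blast
  qed
  have ne: "fst (es ! i) \<noteq> snd (es ! i)" if "i < length es" for i
    using e[OF that] by (cases "fst (es ! i) = snd (es ! i)") auto
  show ?thesis
  proof (rule that[OF es(4) E])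
    show "card E = length es" using es(3) by simp
    \<comment> \<open>A list whose length is the number of edges cannot name an edge twice.\<close>
    show "inj_on ?e {..<length es}"
      using es(3) unfolding E by (intro eq_card_imp_inj_on) auto
    show "\<forall>i<length es. fst (es ! i) \<noteq> snd (es ! i)" "\<forall>i<length es. fst (es ! i) < n \<and> snd (es ! i) < n"
      using e ne by blast+
  qed
qed

lemma length_le_size_of: "length x \<le> size_of x"
  unfolding size_of_def by (induction x) auto

text \<open>Since all vertices are listed, \<open>n\<close> and with it every vertex name is at most
  the length of the input. A name could otherwise be exponential in the input size and take linear
  space to store.\<close>

lemma encodes_bounds:
  assumes "encodes x V E"
  shows "card E \<le> size_of x" "\<forall>v\<in>set x. v \<le> size_of x"
proof -
  obtain n es where x: "x = n # [0..<n] @ length es # concat (map (\<lambda>(u, v). [u, v]) es)"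
    and "E = (\<lambda>i. {fst (es ! i), snd (es ! i)}) ` {..<length es}" and c: "card E = length es"
    and "inj_on (\<lambda>i. {fst (es ! i), snd (es ! i)}) {..<length es}"
    and "\<forall>i<length es. fst (es ! i) \<noteq> snd (es ! i)"
    and n: "\<forall>i<length es. fst (es ! i) < n \<and> snd (es ! i) < n"
    using assms by (rule encodes_cases)
  have len: "length x = n + 2 + 2 * length es" using x by (simp add: length_concat_pairs)
  then show "card E \<le> size_of x" using length_le_size_of[of x] c by simp
  have "v \<le> length x" if v: "v \<in> set x" for v
  proof -
    consider "v \<le> n" | "v = length es" | e where "e \<in> set es" "v \<in> {fst e, snd e}"
      using v unfolding x by auto
    then show ?thesis
    proof cases
      case 3
      then obtain i where "i < length es" "e = es ! i" by (metis in_set_conv_nth)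
      with n 3 len show ?thesis by auto
    qed (use len in auto)
  qed
  then show "\<forall>v\<in>set x. v \<le> size_of x" using length_le_size_of[of x] le_trans by blast
qed

lemma encodes_no_edges: "encodes [0, 0] {} {}"
  by (auto simp: encodes_def simple_graph_def intro!: exI[of _ 0])

lemma encodes_one_edge: "encodes [2, 0, 1, 1, 0, 1] {..<2} {{0, 1}}"
proof -
  have "[0..<2] = [0, 1 :: nat]" by (simp add: upt_rec)
  then show ?thesis
    unfolding encodes_def
    by (intro conjI exI[of _ 2] exI[of _ "[(0, 1)]"]) (auto simp: simple_graph_def)
qed

lemma no_edges_EDS: "([0, 0], 0) \<in> EDS"
  unfolding EDS_iff[OF encodes_no_edges]
  by (auto simp: edge_dominating_set_def intro!: exI[of _ "{}"])

lemma one_edge_not_EDS: "([2, 0, 1, 1, 0, 1], 0) \<notin> EDS"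
proof
  assume "([2, 0, 1, 1, 0, 1], 0) \<in> EDS"
  then obtain S where S: "edge_dominating_set {{0, 1 :: nat}} S" "card S \<le> 0"
    unfolding EDS_iff[OF encodes_one_edge] by blast
  then have "S \<subseteq> {{0, 1}}" by (simp add: edge_dominating_set_def)
  then have "finite S" by (rule finite_subset) simp
  with S(2) have "S = {}" by simp
  with S(1) show False by (simp add: edge_dominating_set_def)
qed

section \<open>Running time and space\<close>

lemma halted_funpow: "halted P s \<Longrightarrow> (step P w ^^ t) s = s"
  by (induction t) (auto simp: step_def)

lemma halted_config_at:
  assumes "halted P (config_at P w t)"
  shows "halts P w" "run_time P w \<le> t" "ram_output P w = outp (config_at P w t)"
proof -
  show "halts P w" using assms by (auto simp: halts_def)
  show le: "run_time P w \<le> t" unfolding run_time_def using assms by (rule Least_le)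
  have h: "halted P (config_at P w (run_time P w))" unfolding run_time_def using assms by (rule LeastI)
  have "config_at P w t = (step P w ^^ (t - run_time P w)) (config_at P w (run_time P w))"
    using le funpow_add[of "t - run_time P w" "run_time P w" "step P w"] by (simp add: config_at_def)
  with halted_funpow[OF h] show "ram_output P w = outp (config_at P w t)"
    by (simp add: ram_output_def)
qed

lemma reaches_halts:
  assumes "reaches P w init_config n s" "halted P s"
  shows "halts P w" "run_time P w \<le> n" "ram_output P w = outp s"
proof -
  from assms obtain t where t: "t \<le> n" "config_at P w t = s"
    by (auto simp: reaches_def config_at_def)
  with assms(2) have "halted P (config_at P w t)" by simp
  from halted_config_at[OF this] t show "halts P w" "run_time P w \<le> n" "ram_output P w = outp s" by auto
qed

section \<open>Space bounds from the shape of the instructions\<close>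

fun slow_growing :: "instr \<Rightarrow> bool" where
  "slow_growing (Const a c) \<longleftrightarrow> a < 40 \<and> c \<le> 2"
| "slow_growing (Add a b c) \<longleftrightarrow> 3 \<le> a \<and> a < 40 \<and> c \<le> 2"
| "slow_growing (Sub a b c) \<longleftrightarrow> 3 \<le> a \<and> a < 40"
| "slow_growing (Read a b) \<longleftrightarrow> a < 40"
| "slow_growing (Write a) \<longleftrightarrow> True"
| "slow_growing (Jump l) \<longleftrightarrow> True"
| "slow_growing (JumpZero a l) \<longleftrightarrow> True"
| "slow_growing _ \<longleftrightarrow> False"

lemma slow_growing_compile: "wf_com c \<Longrightarrow> i \<in> set (compile off c) \<Longrightarrow> slow_growing i"
  by (induction c arbitrary: off) auto

text \<open>Cells 0, 1 and 2 are only set to constants or input words, so they stay at most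
  \<open>W\<close>. Every addition has one of them as second summand and so raises the maximum by at
  most \<open>W\<close>. Without \<open>Load\<close> and \<open>Store\<close> only addresses named
  in the program are touched.\<close>

lemma slow_growing_invariant:
  assumes P: "\<And>i. i \<in> set P \<Longrightarrow> slow_growing i" and W: "2 \<le> W" "\<And>v. v \<in> set w \<Longrightarrow> v \<le> W"
  shows "(\<forall>a. 40 \<le> a \<longrightarrow> mem (config_at P w t) a = 0) \<and>
    (\<forall>a\<le>2. mem (config_at P w t) a \<le> W) \<and> (\<forall>a. mem (config_at P w t) a \<le> W * Suc t)"
    (is "?I (config_at P w t) t")
proof (induction t)
  case 0
  then show ?case by (simp add: config_at_def init_config_def)
next
  case (Suc t)
  let ?s = "config_at P w t"
  have mono: "W * Suc t \<le> W * Suc (Suc t)" "W \<le> W * Suc (Suc t)" by auto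
  have read: "(if p < length w then w ! p else 0) \<le> W" for p using W by simp
  have "?I (exec w i ?s) (Suc t)" if "slow_growing i" for i
  proof -
    have I: "40 \<le> a \<Longrightarrow> mem ?s a = 0" "a \<le> 2 \<Longrightarrow> mem ?s a \<le> W" "mem ?s a \<le> W * Suc t"
      "mem ?s a \<le> W * Suc (Suc t)" for a
      using Suc mono le_trans by blast+
    show ?thesis
    proof (cases i)
      case (Const a c)
      with that I W mono show ?thesis by (auto simp del: mult_Suc_right intro: le_trans)
    next
      case (Add a b c)
      then have "mem ?s b + mem ?s c \<le> W * Suc (Suc t)"
        using that I(3)[of b] I(2)[of c] by simp
      with Add that I show ?thesis by (auto simp del: mult_Suc_right)
    next
      case (Sub a b c)
      have "mem ?s b - mem ?s c \<le> W * Suc (Suc t)" using I(4)[of b] by linarith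
      with Sub that I show ?thesis by (auto simp del: mult_Suc_right)
    next
      case (Read a b)
      define v where "v = (if mem ?s b < length w then w ! mem ?s b else 0)"
      have v: "v \<le> W" using read by (simp add: v_def)
      then have "v \<le> W * Suc (Suc t)" using mono(2) le_trans by blast
      moreover have "mem (exec w i ?s) = (mem ?s)(a := v)" by (simp add: Read v_def)
      ultimately show ?thesis using Read that I v by (simp del: mult_Suc_right)
    qed (use that I in \<open>auto simp del: mult_Suc_right\<close>)
  qed
  moreover have "?I ?s (Suc t)" using Suc mono le_trans by blast
  moreover have "config_at P w (Suc t) = step P w ?s" by (simp add: config_at_def)
  ultimately show ?case
    using P by (cases "halted P ?s") (auto simp: step_def halted_def simp del: mult_Suc_right)
qed

lemma bits_le_iff: "bits n \<le> j \<longleftrightarrow> n < 2 ^ j"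
  by (simp add: bits_def nat_le_iff less_power_nat_iff_bitlen)

lemma bits_mono: "a \<le> b \<Longrightarrow> bits a \<le> bits b"
  using bits_le_iff[of a "bits b"] bits_le_iff[of b "bits b"] by simp

lemma bits_le_self: "bits n \<le> n"
  by (simp add: bits_le_iff)

text \<open>A fixed number of cells with contents bounded by \<open>W\<close> times the running
  time: this turns a polynomial time bound into a logarithmic space bound.\<close>

lemma slow_growing_run_space:
  assumes P: "\<And>i. i \<in> set P \<Longrightarrow> slow_growing i" and W: "2 \<le> W" "\<And>v. v \<in> set w \<Longrightarrow> v \<le> W"
    and t: "run_time P w \<le> n"
  shows "run_space P w \<le> 40 * (6 + bits (W * (n + 1)))"
  unfolding run_space_def
proof (rule Max.boundedI)
  fix y assume "y \<in> (\<lambda>t. config_space (config_at P w t)) ` {..run_time P w}"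
  then obtain t where "t \<le> run_time P w" and y: "y = config_space (config_at P w t)" by auto
  then have "t \<le> n" using t by linarith
  let ?m = "mem (config_at P w t)"
  have I: "40 \<le> a \<Longrightarrow> ?m a = 0" "?m a \<le> W * Suc t" for a
    using slow_growing_invariant[OF P W, where t = t] by auto
  have le: "bits (?m a) \<le> bits (W * (n + 1))" for a
    using I(2)[of a] \<open>t \<le> n\<close> by (intro bits_mono) (auto intro: le_trans mult_le_mono2 simp del: mult_Suc_right)
  have sub: "{a. ?m a \<noteq> 0} \<subseteq> {..<40}" 
  proof
    fix a assume "a \<in> {a. ?m a \<noteq> 0}"
    then have "\<not> 40 \<le> a" using I(1)[of a] by auto
    then show "a \<in> {..<40}" by simp
  qed
  have "config_space (config_at P w t) \<le> (\<Sum>a<40. bits a + bits (?m a))"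
    unfolding config_space_def by (rule sum_mono2[OF _ sub]) auto
  \<comment> \<open>Six bits suffice for an address, as \<open>40 < 2 ^ 6\<close>.\<close>
  also have "\<dots> \<le> (\<Sum>a<40::nat. 6 + bits (W * (n + 1)))"
    using le by (intro sum_mono add_mono) (auto simp: bits_le_iff)
  finally show "y \<le> 40 * (6 + bits (W * (n + 1)))" using y by simp
qed auto

lemma bits_le_log: "1 \<le> n \<Longrightarrow> real (bits n) \<le> 1 + log 2 (real n)"
proof -
  assume n: "1 \<le> n"
  have "\<not> bits n \<le> bits n - 1" using n bits_le_iff[of n 0] by auto
  then have "2 ^ (bits n - 1) \<le> n" unfolding bits_le_iff by simp
  then have "real (2 ^ (bits n - 1)) \<le> real n" by (simp only: of_nat_le_iff)
  then have "2 powr real (bits n - 1) \<le> real n" by (simp add: powr_realpow)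
  then have "real (bits n - 1) \<le> log 2 (real n)"
    using n by (simp add: le_log_iff)
  then show ?thesis by linarith
qed

text \<open>The bound \<open>6000 * 64 ^ k\<close> on the kernel size: \<open>L \<le> 26 k\<^sup>3 \<le> 26 * 8 ^ k\<close> edges yield at most
  \<open>4 L + 2\<close> words, each with at most \<open>2 L\<close> bits.\<close>

definition exp_prog :: ram where
  "exp_prog = [Read 1 0, Const 2 6000, Const 3 1, JumpZero 1 12,
     Add 2 2 2, Add 2 2 2, Add 2 2 2, Add 2 2 2, Add 2 2 2, Add 2 2 2, Sub 1 1 3, Jump 3, Write 2]"

lemma exp_prog_loop:
  assumes "pc s = 3" "mem s 1 = j" "mem s 3 = 1"
  shows "\<exists>t s'. (step exp_prog w ^^ t) s = s' \<and> pc s' = 12 \<and> mem s' 2 = mem s 2 * 64 ^ j \<and> outp s' = outp s"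
  using assms
proof (induction j arbitrary: s)
  case 0
  then show ?case
    by (intro exI[of _ 1]) (simp add: step_def halted_def exp_prog_def)
next
  case (Suc j)
  \<comment> \<open>One round takes nine steps: the test, six doublings, the decrement and the jump
    back.\<close>
  define u where "u = (step exp_prog w ^^ 9) s"
  have u: "pc u = 3" "mem u 1 = j" "mem u 3 = 1" "mem u 2 = mem s 2 * 64" "outp u = outp s"
    using Suc.prems by (simp_all add: u_def eval_nat_numeral step_def halted_def exp_prog_def)
  from Suc.IH[OF u(1-3)] obtain t where "pc ((step exp_prog w ^^ t) u) = 12"
    "mem ((step exp_prog w ^^ t) u) 2 = mem s 2 * 64 * 64 ^ j" "outp ((step exp_prog w ^^ t) u) = outp s"
    using u by auto
  then show ?case
    by (intro exI[of _ "t + 9"]) (simp add: funpow_add u_def)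
qed

text \<open>\<open>kernelization\<close> asks for some computable bound only; a power of 64 needs
  nothing but doublings, whereas a polynomial would call for a multiplication routine.\<close>

lemma computable_exp: "computable (\<lambda>n. 6000 * 64 ^ n)"
  unfolding computable_def
proof (intro exI[of _ exp_prog] allI)
  fix n
  define s where "s = config_at exp_prog [n] 3"
  have s: "pc s = 3" "mem s 1 = n" "mem s 3 = 1" "mem s 2 = 6000" "outp s = []"
    by (simp_all add: s_def config_at_def init_config_def numeral_3_eq_3 step_def halted_def exp_prog_def)
  from exp_prog_loop[OF s(1-3)] obtain t where t: "pc ((step exp_prog [n] ^^ t) s) = 12"
    "mem ((step exp_prog [n] ^^ t) s) 2 = 6000 * 64 ^ n" "outp ((step exp_prog [n] ^^ t) s) = []"
    using s by auto
  have "config_at exp_prog [n] (Suc t + 3) = step exp_prog [n] ((step exp_prog [n] ^^ t) s)"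
    unfolding config_at_def s_def funpow_add by simp
  also have "\<dots> = exec [n] (Write 2) ((step exp_prog [n] ^^ t) s)"
    using t(1) by (simp add: step_def halted_def exp_prog_def)
  finally have "halted exp_prog (config_at exp_prog [n] (Suc t + 3))"
    "outp (config_at exp_prog [n] (Suc t + 3)) = [6000 * 64 ^ n]"
    using t by (simp_all add: halted_def exp_prog_def)
  with halted_config_at[of exp_prog "[n]"] show "halts exp_prog [n] \<and> ram_output exp_prog [n] = [6000 * 64 ^ n]"
    by auto
qed

section \<open>The complete program\<close>

text \<open>The input consists of \<open>k\<close>, \<open>n\<close>, the \<open>n\<close> vertices,
  \<open>m\<close>, and the edges from position \<open>n + 3\<close> on. The vertex list is skipped
  by computing addresses, because a running time bounded in \<open>|E|\<close> leaves no time to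
  scan isolated vertices.\<close>

definition prelude :: ram where
  "prelude = [Const ONE 1, Read PAR ZERO, Read TMP ONE, Add TMP TMP ONE, Add TMP TMP ONE,
     Read EDGES TMP, Add BASE TMP ONE, Add END BASE EDGES, Add END END EDGES, Add PAR2 PAR PAR]"

definition kernel_prog :: ram where
  "kernel_prog = prelude @ compile 10 kernel_com"

lemma slow_growing_kernel_prog: "i \<in> set kernel_prog \<Longrightarrow> slow_growing i"
  using slow_growing_compile[OF wf_kernel_com] by (auto simp: kernel_prog_def prelude_def)

lemma prelude_run:
  assumes "w = k # n # [0..<n] @ m # xs"
  shows "\<exists>s. reaches kernel_prog w init_config 10 s \<and> pc s = 10 \<and> outp s = [] \<and>
    mem s ONE = 1 \<and> mem s PAR = k \<and> mem s EDGES = m \<and> mem s PAR2 = 2 * k \<and>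
    mem s BASE = n + 3 \<and> mem s END = n + 3 + 2 * m \<and> mem s ZERO = 0"
proof -
  have w: "w ! 0 = k" "w ! Suc 0 = n" "w ! Suc (Suc n) = m" "Suc (Suc n) < length w" "w \<noteq> []"
    "Suc 0 < length w"
    using assms by (simp_all add: nth_append)
  have len: "length prelude = 10" by (simp add: prelude_def)
  have P: "kernel_prog ! i = prelude ! i" "i < length kernel_prog" if "i < 10" for i
    using that by (simp_all add: kernel_prog_def nth_append len)
  define s where "s = (step kernel_prog w ^^ 10) init_config"
  have st: "step kernel_prog w c = exec w (prelude ! pc c) c" if "pc c < 10" for c
    using that P[of "pc c"] by (simp add: step_def halted_def)
  have "pc s = 10 \<and> outp s = [] \<and>
    mem s ONE = 1 \<and> mem s PAR = k \<and> mem s EDGES = m \<and> mem s PAR2 = 2 * k \<and>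
    mem s BASE = n + 3 \<and> mem s END = n + 3 + 2 * m \<and> mem s ZERO = 0"
    by (simp add: s_def init_config_def st prelude_def w eval_nat_numeral)
  moreover have "reaches kernel_prog w init_config 10 s"
    by (auto simp: reaches_def s_def)
  ultimately show ?thesis by blast
qed

lemma size_of_le: "(\<And>v. v \<in> set x \<Longrightarrow> v \<le> c) \<Longrightarrow> size_of x \<le> length x * (c + 1)"
proof (induction x)
  case (Cons v x)
  have "bits v \<le> c" using Cons.prems[of v] bits_le_self[of v] by simp
  moreover have "size_of x \<le> length x * (c + 1)" using Cons by simp
  ultimately show ?case by (simp add: size_of_def)
qed (simp add: size_of_def)

lemma kernel_size_bound:
  assumes "L \<le> 26 * k ^ 3"
  shows "(4 * L + 2) * (2 * L + 1) + k \<le> 6000 * 64 ^ k"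
proof -
  define q :: nat where "q = 8 ^ k"
  have "k \<le> 2 ^ k" using less_exp[of k] by simp
  then have "k ^ 3 \<le> (2 ^ k) ^ 3" by (rule power_mono) simp
  also have "(2 ^ k) ^ 3 = q" unfolding q_def by (simp add: power_mult [symmetric] mult.commute[of k] power_mult[of 2 3])
  finally have L: "L \<le> 26 * q" using assms by linarith
  have q: "1 \<le> q" by (simp add: q_def)
  have "(2 :: nat) ^ k \<le> 8 ^ k" by (rule power_mono) auto
  with \<open>k \<le> 2 ^ k\<close> have k: "k \<le> q" unfolding q_def by linarith
  \<comment> \<open>\<open>4 * 26 + 2 = 106\<close> and \<open>2 * 26 + 1 = 53\<close>, using
    \<open>1 \<le> q\<close>; the product 5618 leaves room below 6000 for the summand
    \<open>k\<close>.\<close>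
  have "(4 * L + 2) * (2 * L + 1) \<le> (106 * q) * (53 * q)"
    using L q by (intro mult_le_mono) linarith+
  moreover have "q \<le> q * q" using q by simp
  moreover have "q * q = 64 ^ k" by (simp add: q_def flip: power_mult_distrib)
  ultimately show ?thesis using k by linarith
qed

text \<open>The \<open>+ 1\<close> in the edge bound accounts for the fixed no-instance, whose
  single edge exceeds \<open>26 * k ^ 3\<close> when \<open>k = 0\<close>.\<close>

lemma kernel_prog_correct:
  assumes enc: "encodes x V E"
  shows "halts kernel_prog (k # x)" (is ?halts)
    and "run_time kernel_prog (k # x) \<le> 10 + cost (card E) kernel_com" (is ?time)
    and "\<exists>x' k' V' E'. ram_output kernel_prog (k # x) = k' # x' \<and> encodes x' V' E' \<and>
      card E' \<le> 26 * k ^ 3 + 1 \<and> size_of x' + k' \<le> 6000 * 64 ^ k \<and> ((x, k) \<in> EDS \<longleftrightarrow> (x', k') \<in> EDS)"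
      (is ?output)
proof -
  obtain n es where x: "x = n # [0..<n] @ length es # concat (map (\<lambda>(u, v). [u, v]) es)"
    and E: "E = (\<lambda>i. {fst (es ! i), snd (es ! i)}) ` {..<length es}" and c: "card E = length es"
    and inj: "inj_on (\<lambda>i. {fst (es ! i), snd (es ! i)}) {..<length es}"
    and ne: "\<forall>i<length es. fst (es ! i) \<noteq> snd (es ! i)"
    and "\<forall>i<length es. fst (es ! i) < n \<and> snd (es ! i) < n"
    using enc by (rule encodes_cases)
  let ?m = "length es"
  have tail: "read_word (k # x) (n + 3 + j) = concat (map (\<lambda>(u, v). [u, v]) es) ! j"
    if "j < 2 * ?m" for j
    using that unfolding x by (simp add: read_word_def nth_append length_concat_pairs eval_nat_numeral)
  interpret edge_graph "k # x" "n + 3" ?m k "\<lambda>i. fst (es ! i)" "\<lambda>i. snd (es ! i)"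
  proof
    fix i assume i: "i < ?m"
    show "read_word (k # x) (n + 3 + 2 * i) = fst (es ! i)"
      using tail[of "2 * i"] i by (simp add: nth_concat_pairs)
    show "read_word (k # x) (Suc (n + 3 + 2 * i)) = snd (es ! i)"
      using tail[of "Suc (2 * i)"] i by (simp add: nth_concat_pairs)
    show "fst (es ! i) \<noteq> snd (es ! i)" using ne i by blast
  qed (rule inj)
  have edges: "edges = E" by (simp add: E edges_def edge_def[abs_def])
  obtain s where s: "reaches kernel_prog (k # x) init_config 10 s" "pc s = 10" "outp s = []" "set_up s"
    using prelude_run[of "k # x" k n ?m "concat (map (\<lambda>(u, v). [u, v]) es)"] x
    unfolding set_up_def by blast
  have "code_at kernel_prog 10 (compile 10 kernel_com)"
    unfolding code_at_def kernel_prog_def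
    by (intro exI[of _ prelude] exI[of _ "[]"]) (simp add: prelude_def)
  moreover have "ready (n + 3) ?m s" using s(4) by (simp add: set_up_def ready_def)
  ultimately have "reaches kernel_prog (k # x) s (cost ?m kernel_com) ((run kernel_com s)\<lparr>pc := 10 + code_len kernel_com\<rparr>)"
    using compile_correct[OF wf_kernel_com] s(2) by blast
  from reaches_trans[OF s(1) this]
  have r: "reaches kernel_prog (k # x) init_config (10 + cost ?m kernel_com)
      ((run kernel_com s)\<lparr>pc := 10 + code_len kernel_com\<rparr>)" .
  have h: "halted kernel_prog ((run kernel_com s)\<lparr>pc := 10 + code_len kernel_com\<rparr>)"
    by (simp add: halted_def kernel_prog_def prelude_def)
  show ?halts ?time using reaches_halts(1,2)[OF r h] c by simp_all
  have out: "ram_output kernel_prog (k # x) = kernel_output"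
    using reaches_halts(3)[OF r h] kernel_com[OF s(4,3)] by simp
  have eds: "(x, k) \<in> EDS \<longleftrightarrow> (\<exists>S. edge_dominating_set edges S \<and> card S \<le> k)"
    using EDS_iff[OF enc] edges by simp
  have one: "1 \<le> (64 :: nat) ^ k" by simp
  show ?output
  proof (cases "?m \<le> k")
    case True
    have "edge_dominating_set E E" by (simp add: edge_dominating_set_def)
    with True c eds edges have "(x, k) \<in> EDS" by auto
    moreover have "ram_output kernel_prog (k # x) = 0 # [0, 0]"
      using out True by (simp add: kernel_output_def)
    moreover have "size_of [0, 0] \<le> 2"
      using size_of_le[of "[0, 0]" 0] by auto
    then have "size_of [0, 0] + 0 \<le> 6000 * 64 ^ k" using one by linarith
    ultimately show ?thesis
      using encodes_no_edges no_edges_EDS by (intro exI[of _ "[0, 0]"] exI[of _ 0] exI[of _ "{}"]) simp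
  next
    case mk: False
    show ?thesis
    proof (cases "length (kept ?m) \<le> 26 * k ^ 3")
      case True
      let ?L = "length (kept ?m)"
      let ?x = "2 * ?L # [0..<2 * ?L] @ ?L # concat (map (\<lambda>j. [label (fst (es ! j)), label (snd (es ! j))]) (kept ?m))"
      let ?E = "(`) label ` kernel_edges"
      have len: "length ?x = 4 * ?L + 2"
        by (simp add: length_concat comp_def sum_list_triv)
      have "v \<le> 2 * ?L" if v: "v \<in> set ?x" for v
      proof -
        consider "v \<le> 2 * ?L" | a where "a \<in> set (ends ?m)" "v = label a"
          using v unfolding ends_def by auto
        then show ?thesis using label_less by cases (auto simp: set_ends intro: less_imp_le)
      qed
      then have "size_of ?x \<le> (4 * ?L + 2) * (2 * ?L + 1)"
        using size_of_le[of ?x "2 * ?L"] len by simp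
      then have "size_of ?x + k \<le> 6000 * 64 ^ k"
        using kernel_size_bound[OF True] by linarith
      moreover have "card ?E \<le> 26 * k ^ 3 + 1"
      proof -
        have "card ?E \<le> card kernel_edges" by (rule card_image_le) (simp add: kernel_edges_def)
        with True show ?thesis by (simp add: card_kernel_edges)
      qed
      moreover have "ram_output kernel_prog (k # x) = k # ?x"
        using out mk True by (simp add: kernel_output_def)
      moreover have "(x, k) \<in> EDS \<longleftrightarrow> (?x, k) \<in> EDS"
        unfolding eds EDS_iff[OF encodes_kernel] by (rule relabelled_kernel_equivalent)
      ultimately show ?thesis using encodes_kernel by blast
    next
      case False
      have "(x, k) \<notin> EDS" using kernel_small False unfolding eds by blast
      moreover have "ram_output kernel_prog (k # x) = 0 # [2, 0, 1, 1, 0, 1]"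
        using out mk False by (simp add: kernel_output_def)
      moreover have "size_of [2, 0, 1, 1, 0, 1] \<le> 18"
        by (rule order_trans[OF size_of_le[where c = 2]]) auto
      then have "size_of [2, 0, 1, 1, 0, 1] + 0 \<le> 6000 * 64 ^ k" using one by linarith
      ultimately show ?thesis
        using encodes_one_edge one_edge_not_EDS
        by (intro exI[of _ "[2, 0, 1, 1, 0, 1]"] exI[of _ 0] exI[of _ "{..<2}"] exI[of _ "{{0, 1}}"]) simp
    qed
  qed
qed

section \<open>Asymptotic form of the bounds\<close>

lemma time_bigo: "(\<lambda>m. real (10 + A * (m + 1) ^ 4)) \<in> O(\<lambda>m. real m ^ 4)"
proof (rule bigoI)
  show "eventually (\<lambda>m. norm (real (10 + A * (m + 1) ^ 4)) \<le> real (10 + 16 * A) * norm (real m ^ 4)) sequentially"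
    using eventually_ge_at_top[of 1]
  proof eventually_elim
    case (elim m)
    have "(m + 1) ^ 4 \<le> (2 * m) ^ 4" using elim by (intro power_mono) auto
    then have "A * (m + 1) ^ 4 \<le> 16 * A * m ^ 4" by (simp add: power_mult_distrib)
    moreover have "10 \<le> 10 * m ^ 4" using elim by simp
    ultimately have "10 + A * (m + 1) ^ 4 \<le> (10 + 16 * A) * m ^ 4"
      unfolding add_mult_distrib by linarith
    then have "real (10 + A * (m + 1) ^ 4) \<le> real ((10 + 16 * A) * m ^ 4)" by (simp only: of_nat_le_iff)
    then show ?case by simp
  qed
qed

text \<open>Cell contents are at most a constant times \<open>n ^ 5\<close>: a word bound
  \<open>n + 2\<close> times a running time of order \<open>n ^ 4\<close>.\<close>

lemma space_bigo:
  "(\<lambda>n. real (40 * (6 + bits ((n + 2) * (10 + A * (n + 1) ^ 4 + 1))))) \<in> O(\<lambda>n. ln (real n))"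
proof -
  define C where "C = real (22 + 32 * A)"
  define D where "D = 40 * (7 + log 2 C + 5 / ln 2)"
  have C1: "1 \<le> C" by (simp add: C_def)
  show ?thesis
  proof (rule bigoI[where c = D])
    show "eventually (\<lambda>n. norm (real (40 * (6 + bits ((n + 2) * (10 + A * (n + 1) ^ 4 + 1))))) \<le>
        D * norm (ln (real n))) sequentially"
      \<comment> \<open>From 3 on, \<open>ln (real n)\<close> is at least 1, so additive constants
        can be absorbed into \<open>D\<close>.\<close>
      using eventually_ge_at_top[of 3]
    proof eventually_elim
      case (elim n)
      let ?v = "(n + 2) * (10 + A * (n + 1) ^ 4 + 1)"
      have "(n + 1) ^ 4 \<le> (2 * n) ^ 4" using elim by (intro power_mono) auto
      then have "A * (n + 1) ^ 4 \<le> 16 * A * n ^ 4" by (simp add: power_mult_distrib)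
      moreover have "11 \<le> 11 * n ^ 4" using elim by simp
      ultimately have "10 + A * (n + 1) ^ 4 + 1 \<le> (11 + 16 * A) * n ^ 4"
        unfolding add_mult_distrib by linarith
      then have "?v \<le> (2 * n) * ((11 + 16 * A) * n ^ 4)"
        using elim by (intro mult_le_mono) auto
      also have "\<dots> = (22 + 32 * A) * n ^ 5" by (simp add: algebra_simps power_Suc eval_nat_numeral)
      finally have "real ?v \<le> real ((22 + 32 * A) * n ^ 5)" by (simp only: of_nat_le_iff)
      then have v: "real ?v \<le> C * real n ^ 5" by (simp add: C_def)
      have e: "exp 1 \<le> real n" using elim exp_le by linarith
      then have ln1: "1 \<le> ln (real n)" using elim by (subst ln_ge_iff) auto
      have "real (bits ?v) \<le> 1 + log 2 (real ?v)" by (rule bits_le_log) simp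
      also have "log 2 (real ?v) \<le> log 2 (C * real n ^ 5)"
        using v by (subst log_le_cancel_iff) (use C1 elim in \<open>auto simp del: of_nat_mult of_nat_add\<close>)
      also have "log 2 (C * real n ^ 5) = log 2 C + 5 * log 2 (real n)"
        using C1 elim by (simp add: log_mult log_nat_power)
      also have "log 2 (real n) = ln (real n) / ln 2" by (simp add: log_def)
      finally have b: "real (bits ?v) \<le> 1 + log 2 C + 5 / ln 2 * ln (real n)" by simp
      have "0 \<le> log 2 C" using C1 by simp
      then have "7 + log 2 C \<le> (7 + log 2 C) * ln (real n)" using ln1 mult_left_mono[OF ln1, of "7 + log 2 C"] by simp
      with b have "6 + real (bits ?v) \<le> (7 + log 2 C + 5 / ln 2) * ln (real n)"
        unfolding distrib_right by linarith
      then have "real (40 * (6 + bits ?v)) \<le> 40 * ((7 + log 2 C + 5 / ln 2) * ln (real n))"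
        unfolding of_nat_mult of_nat_add of_nat_numeral by (rule mult_left_mono) simp
      then have "real (40 * (6 + bits ?v)) \<le> D * ln (real n)" by (simp only: D_def mult.assoc)
      moreover have "norm (ln (real n)) = ln (real n)" using ln1 by simp
      ultimately show ?case unfolding real_norm_def abs_of_nat by (simp only:)
    qed
  qed
qed

theorem theorem3:
  shows "\<exists>P. logspace_kernelization P EDS_instances EDS \<and>
    (\<exists>T :: nat \<Rightarrow> nat. (\<lambda>m. real (T m)) \<in> O(\<lambda>m. real m ^ 4) \<and>
       (\<forall>x k V E. encodes x V E \<longrightarrow> run_time P (k # x) \<le> T (card E))) \<and>
    (\<exists>B :: nat \<Rightarrow> nat. (\<lambda>k. real (B k)) \<in> O(\<lambda>k. real k ^ 3) \<and>
       (\<forall>x k V E x' k' V' E'. encodes x V E \<longrightarrow> ram_output P (k # x) = k' # x' \<longrightarrow>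
          encodes x' V' E' \<longrightarrow> card E' \<le> B k))"
proof -
  obtain A where A: "\<And>m. cost m kernel_com \<le> A * (m + 1) ^ 4"
    using cost_le_power_depth[of kernel_com] by (auto simp: depth_kernel_com)
  define T where "T m = 10 + A * (m + 1) ^ 4" for m
  \<comment> \<open>The bound \<open>T\<close> in the number of edges also serves as polynomial
    bound in the input size and enters the space bound; monotonicity makes the transfer.\<close>
  have T_mono: "T m \<le> T m'" if "m \<le> m'" for m m'
    using that unfolding T_def by (intro add_left_mono mult_le_mono2 power_mono) auto
  have T: "run_time kernel_prog (k # x) \<le> T (card E)" if "encodes x V E" for k x V E
    using kernel_prog_correct(2)[OF that, of k] A[of "card E"] by (simp add: T_def)
  have T_bigo: "(\<lambda>m. real (T m)) \<in> O(\<lambda>m. real m ^ 4)"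
    unfolding T_def by (rule time_bigo)
  have T_size: "run_time kernel_prog (k # x) \<le> T (size_of x + k)" if "encodes x V E" for k x V E
    using T[OF that, of k] T_mono[of "card E" "size_of x + k"] encodes_bounds(1)[OF that] by linarith
  have kernelization: "kernelization kernel_prog EDS_instances EDS"
    unfolding kernelization_def
  proof (intro conjI)
    show "\<forall>(x, k)\<in>EDS_instances. halts kernel_prog (k # x)"
      using kernel_prog_correct(1) by (auto simp: EDS_instances_def)
    show "\<exists>T d. (\<lambda>n. real (T n)) \<in> O(\<lambda>n. real n ^ d) \<and>
        (\<forall>(x, k)\<in>EDS_instances. run_time kernel_prog (k # x) \<le> T (size_of x + k))"
      using T_bigo T_size by (intro exI[of _ T] exI[of _ 4]) (auto simp: EDS_instances_def)
    show "\<exists>g. computable g \<and> (\<forall>(x, k)\<in>EDS_instances. \<exists>x' k'. ram_output kernel_prog (k # x) = k' # x' \<and>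
        (x', k') \<in> EDS_instances \<and> size_of x' + k' \<le> g k \<and> ((x, k) \<in> EDS \<longleftrightarrow> (x', k') \<in> EDS))"
    proof (intro exI[of _ "\<lambda>k. 6000 * 64 ^ k"] conjI computable_exp ballI, clarify)
      fix x k assume "(x, k) \<in> EDS_instances"
      then obtain V E where "encodes x V E" by (auto simp: EDS_instances_def)
      from kernel_prog_correct(3)[OF this, of k]
      show "\<exists>x' k'. ram_output kernel_prog (k # x) = k' # x' \<and>
        (x', k') \<in> EDS_instances \<and> size_of x' + k' \<le> 6000 * 64 ^ k \<and> ((x, k) \<in> EDS \<longleftrightarrow> (x', k') \<in> EDS)"
        unfolding EDS_instances_def by blast
    qed
  qed
  \<comment> \<open>Here \<open>W\<close> is \<open>size_of x + k + 2\<close>, which dominates all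
    input words, \<open>k\<close> included, and the constants up to 2.\<close>
  have "run_space kernel_prog (k # x) \<le> 40 * (6 + bits ((size_of x + k + 2) * (T (size_of x + k) + 1)))"
    if "encodes x V E" for k x V E
    using encodes_bounds(2)[OF that]
    by (intro slow_growing_run_space[OF slow_growing_kernel_prog _ _ T_size[OF that]]) auto
  then have space: "\<exists>S. (\<lambda>n. real (S n)) \<in> O(\<lambda>n. ln (real n)) \<and>
      (\<forall>(x, k)\<in>EDS_instances. run_space kernel_prog (k # x) \<le> S (size_of x + k))"
    using space_bigo[of A]
    by (intro exI[of _ "\<lambda>n. 40 * (6 + bits ((n + 2) * (T n + 1)))"]) (auto simp: EDS_instances_def T_def)
  have B_bigo: "(\<lambda>k. real (26 * k ^ 3 + 1)) \<in> O(\<lambda>k. real k ^ 3)"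
  proof (rule bigoI)
    show "eventually (\<lambda>k. norm (real (26 * k ^ 3 + 1)) \<le> 27 * norm (real k ^ 3)) sequentially"
      using eventually_ge_at_top[of 1] by eventually_elim auto
  qed
  \<comment> \<open>The output encodes the edge set of only one graph, so the bound for the
    constructed kernel holds for whatever \<open>E'\<close> it is decoded to.\<close>
  have B: "card E' \<le> 26 * k ^ 3 + 1"
    if "encodes x V E" "ram_output kernel_prog (k # x) = k' # x'" "encodes x' V' E'" for x k V E x' k' V' E'
    using kernel_prog_correct(3)[OF that(1), of k] that(2,3) encodes_unique by force
  show ?thesis
  proof (intro exI[of _ kernel_prog] conjI)
    show "logspace_kernelization kernel_prog EDS_instances EDS"
      unfolding logspace_kernelization_def using kernelization space by blast
    show "\<exists>T. (\<lambda>m. real (T m)) \<in> O(\<lambda>m. real m ^ 4) \<and>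
       (\<forall>x k V E. encodes x V E \<longrightarrow> run_time kernel_prog (k # x) \<le> T (card E))"
      using T T_bigo by blast
    show "\<exists>B. (\<lambda>k. real (B k)) \<in> O(\<lambda>k. real k ^ 3) \<and>
       (\<forall>x k V E x' k' V' E'. encodes x V E \<longrightarrow> ram_output kernel_prog (k # x) = k' # x' \<longrightarrow>
          encodes x' V' E' \<longrightarrow> card E' \<le> B k)"
      by (intro exI[of _ "\<lambda>k. 26 * k ^ 3 + 1"] conjI B_bigo allI impI) (rule B)
  qed
qed

end
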